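(* Let $\mathfrak{b}(n)$ be defined by $$\sum_{n\ge 0}\mathfrak{b}(n)q^n=\beta(q):=\sum_{n\ge 0}\frac{q^{n(n+1)}(-q^2;q^2)_n}{(q;q^2)_{n+1}^2}.$$ Then for all integers $\alpha\ge 1$ and $n\ge 0$, $$\mathfrak{b}\left(2\cdot 3^{2\alpha-1}n+\frac{3^{2\alpha}-1}{2}\right)\equiv 0 \pmod{3^{2\alpha}}.$$
   Context: For $a$ and a variable $q$, $(a;q)_n=\prod_{k=0}^{n-1}(1-aq^k)$ and $(a;q)_\infty=\prod_{k\ge0}(1-aq^k)$. The series $\beta(q)$ (a second order mock theta function) is regarded as a formal power series in $q$ with integer coefficients. *)

theory Defs
  imports "HOL-Computational_Algebra.Formal_Power_Series"
begin

definition qpoch :: "'a::comm_ring_1 fps \<Rightarrow> 'a fps \<Rightarrow> nat \<Rightarrow> 'a fps" where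
  "qpoch a q n = (\<Prod>k<n. 1 - a * q ^ k)"

text \<open>The n-th summand of beta(q), as a formal power series over the rationals
  (the denominator has constant term 1, hence is invertible).\<close>
definition beta_term :: "nat \<Rightarrow> rat fps" where
  "beta_term n = fps_X ^ (n * (n + 1)) * qpoch (- (fps_X ^ 2)) (fps_X ^ 2) n
                 * inverse ((qpoch fps_X (fps_X ^ 2) (n + 1)) ^ 2)"

text \<open>Coefficients of beta(q) = sum of beta_term n. The n-th summand is divisible by
  q^(n(n+1)), so only summands with n \<le> m contribute to the coefficient of q^m.\<close>
definition frakb :: "nat \<Rightarrow> rat" where
  "frakb m = (\<Sum>n\<le>m. fps_nth (beta_term n) m)"

end

theory Submission
  imports Defs
begin

text \<open>
  By Fine's transformation, \<open>\<beta>(q)\<close> equals the sum over \<open>n \<ge> 0\<close> of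
  \<open>q\<^sup>n (-q;q\<^sup>2)\<^sub>n / (q;q\<^sup>2)\<^sub>n\<^sub>+\<^sub>1\<close>, and the terms with \<open>n < 0\<close> of the same expression add up to
  \<open>\<beta>(-q)\<close>. Ramanujan's bilateral summation therefore evaluates the even part:
  \<open>f(q) = \<Sum>\<^sub>n b(2n) q\<^sup>n = J\<^sub>2\<^sup>5 / J\<^sub>1\<^sup>4\<close>, where \<open>J\<^sub>m = (q\<^sup>m;q\<^sup>m)\<^sub>\<infinity>\<close>.

  The 3-dissections of \<open>\<phi>(-q)\<close> and \<open>\<psi>(q)\<close> express \<open>f(q) / f(q\<^sup>9)\<close> rationally in Ramanujan's cubic
  continued fraction \<open>s\<close>, and the modular equation of the latter gives a function \<open>x\<close> that is cubic
  over the polynomials in \<open>y = x(q\<^sup>3)\<close>: with \<open>r = s / (1 - 2 s)\<close> one has \<open>x = r + 3 r\<^sup>2 + 3 r\<^sup>3\<close> and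
  \<open>r\<^sup>3 = y (1 + 6 r + 12 r\<^sup>2)\<close>. Hence extracting the exponents 0 modulo 3 from a polynomial \<open>p(x)\<close>,
  or the exponents 2 modulo 3 from \<open>f(q) p(x)\<close>, yields polynomials in \<open>x\<close> again (in the second case
  times \<open>f(q\<^sup>3)\<close>). Two lattices of integer polynomials, defined by 3-adic weights on the
  coefficients, are mapped into each other by these operators, the second one producing an additional
  factor 9. Iterating the two operators proves the congruence.
\<close>

unbundle fps_syntax

section \<open>Infinite products and sums of formal power series\<close>

text \<open>Congruence modulo \<open>X ^ N\<close>. Limits are handled by comparing infinite sums
  and products with finite ones in this sense, for every \<open>N\<close>.\<close>

definition feq :: "nat \<Rightarrow> 'a::zero fps \<Rightarrow> 'a fps \<Rightarrow> bool" where
  "feq N F G \<longleftrightarrow> (\<forall>n<N. F $ n = G $ n)"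

lemma feq_refl [simp, intro]: "feq N F F"
  by (simp add: feq_def)

lemma feq_sym: "feq N F G \<Longrightarrow> feq N G F"
  by (simp add: feq_def)

lemma feq_trans [trans]: "feq N F G \<Longrightarrow> feq N G H \<Longrightarrow> feq N F H"
  by (simp add: feq_def)

lemma feq_add: "feq N F G \<Longrightarrow> feq N F' G' \<Longrightarrow> feq N (F + F') (G + G')"
  for F G :: "'a::comm_ring_1 fps"
  by (simp add: feq_def)

lemma feq_diff: "feq N F G \<Longrightarrow> feq N F' G' \<Longrightarrow> feq N (F - F') (G - G')"
  for F G :: "'a::comm_ring_1 fps"
  by (simp add: feq_def)

lemma feq_mult: "feq N F G \<Longrightarrow> feq N F' G' \<Longrightarrow> feq N (F * F') (G * G')"
  for F G :: "'a::comm_ring_1 fps"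
  by (auto simp: feq_def fps_mult_nth intro!: sum.cong)

lemma feq_prod: "(\<And>i. i \<in> I \<Longrightarrow> feq N (F i) (G i)) \<Longrightarrow> feq N (prod F I) (prod G I)"
  for F G :: "'b \<Rightarrow> 'a::comm_ring_1 fps"
  by (induction I rule: infinite_finite_induct) (auto intro: feq_mult)

lemma feq_inverse:
  fixes F G :: "'a::field fps"
  assumes "feq N F G" "F $ 0 \<noteq> 0" "G $ 0 \<noteq> 0"
  shows "feq N (inverse F) (inverse G)"
proof -
  have "feq N (inverse F * (G * inverse G)) (inverse F * (F * inverse G))"
    by (intro feq_mult feq_refl feq_sym[OF assms(1)])
  moreover have "G * inverse G = 1" "inverse F * (F * inverse G) = inverse G"
    using assms(2,3) by (simp_all add: inverse_mult_eq_1' inverse_mult_eq_1 flip: mult.assoc)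
  ultimately show ?thesis by simp
qed

lemma feq_eqI: "(\<And>N. feq N F G) \<Longrightarrow> F = G"
  by (auto simp: feq_def fps_eq_iff)

lemma feq_power_0:
  fixes Q :: "'a::comm_ring_1 fps"
  assumes "Q $ 0 = 0" "N \<le> k"
  shows "feq N (c * Q ^ k) 0"
proof -
  have "(Q ^ k) $ n = 0" if "n < k" for n
    using startsby_zero_power_prefix[OF assms(1)] that by blast
  then show ?thesis using assms(2) by (auto simp: feq_def fps_mult_nth)
qed

lemma feq_compose:
  fixes F G h :: "'a::comm_ring_1 fps"
  assumes "feq N F G" shows "feq N (F oo h) (G oo h)"
  using assms by (auto simp: feq_def fps_compose_nth)

text \<open>Only meaningful for \<open>q\<close> without constant term, where the coefficients of the partial products stabilise.\<close>

definition qinf :: "'a::comm_ring_1 fps \<Rightarrow> 'a fps \<Rightarrow> 'a fps" where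
  "qinf a q = Abs_fps (\<lambda>n. qpoch a q (Suc n) $ n)"

lemma qpoch_nth_0: "a $ 0 = 0 \<Longrightarrow> qpoch a q n $ 0 = 1"
  by (induction n) (auto simp: qpoch_def)

lemma feq_qpoch:
  assumes "q $ 0 = 0" "N \<le> M" "N \<le> M'"
  shows "feq N (qpoch a q M) (qpoch a q M')"
proof -
  have *: "feq N (qpoch a q M) (qpoch a q N)" if "N \<le> M" for M
    using that
  proof (induction M rule: dec_induct)
    case (step m)
    have "feq N (1 - a * q ^ m) (1 - 0)"
      by (intro feq_diff feq_refl feq_power_0 assms step)
    from feq_mult[OF step.IH this] show ?case by (simp add: qpoch_def)
  qed auto
  show ?thesis using *[OF assms(2)] *[OF assms(3)] feq_sym feq_trans by blast
qed

lemma feq_qinf: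
  assumes "q $ 0 = 0" "N \<le> M"
  shows "feq N (qinf a q) (qpoch a q M)"
  unfolding feq_def
proof (intro allI impI)
  fix n assume "n < N"
  then show "qinf a q $ n = qpoch a q M $ n"
    using feq_qpoch[OF assms(1), of "Suc n" "Suc n" M a] assms(2)
    by (auto simp: qinf_def feq_def)
qed

text \<open>The slack \<open>g\<close> admits partial products with more than \<open>N\<close>
  factors, as they arise when factors are distributed over residue classes.\<close>

lemma qinf_eqI:
  assumes "q $ 0 = 0" "\<And>N. feq N F (qpoch a q (N + g N))"
  shows "F = qinf a q"
proof (rule feq_eqI)
  fix N
  show "feq N F (qinf a q)"
    using assms(2)[of N] feq_sym[OF feq_qinf[OF assms(1)]] feq_trans by (metis le_add1)
qed

lemma qinf_0 [simp]: "qinf 0 q = 1"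
  by (auto simp: qinf_def qpoch_def fps_eq_iff)

lemma qinf_nth_0: "a $ 0 = 0 \<Longrightarrow> qinf a q $ 0 = 1"
  by (simp add: qinf_def qpoch_def)

lemma qinf_nonzero: "a $ 0 = 0 \<Longrightarrow> qinf a q \<noteq> 0"
  using qinf_nth_0[of a q] by auto

lemma qpoch_Suc_left: "qpoch a q (Suc n) = (1 - a) * qpoch (a * q) q n"
  unfolding qpoch_def by (subst prod.lessThan_Suc_shift) (simp add: mult_ac)

lemma qinf_rec:
  assumes "q $ 0 = 0" shows "qinf a q = (1 - a) * qinf (a * q) q"
proof (rule qinf_eqI[OF assms, symmetric, of _ _ "\<lambda>_. 1"])
  fix N
  show "feq N ((1 - a) * qinf (a * q) q) (qpoch a q (N + 1))"
    using feq_mult[OF feq_refl feq_qinf[OF assms order.refl]] by (simp add: qpoch_Suc_left)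
qed

lemma prod_lessThan_add: "(\<Prod>k<m + n. f k) = (\<Prod>k<m. f k) * (\<Prod>k<n. f (m + k))"
  for f :: "nat \<Rightarrow> 'a::comm_monoid_mult"
  by (induction n) (simp_all add: mult.assoc)

lemma qpoch_split:
  "m > 0 \<Longrightarrow> qpoch a q (m * n) = (\<Prod>j<m. qpoch (a * q ^ j) (q ^ m) n)"
proof (induction n)
  case (Suc n)
  have "qpoch a q (m * Suc n) = (\<Prod>k<m * n + m. 1 - a * q ^ k)"
    by (simp add: qpoch_def add.commute)
  also have "\<dots> = qpoch a q (m * n) * (\<Prod>j<m. 1 - a * q ^ (m * n + j))"
    by (simp only: qpoch_def prod_lessThan_add)
  also have "\<dots> = (\<Prod>j<m. qpoch (a * q ^ j) (q ^ m) (Suc n))"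
    using Suc by (simp add: qpoch_def prod.distrib power_add mult_ac flip: power_mult)
  finally show ?case .
qed (auto simp: qpoch_def)

text \<open>The factors are sorted by their index modulo \<open>m\<close>.\<close>

lemma qinf_split:
  assumes "q $ 0 = 0" "m > 0"
  shows "qinf a q = (\<Prod>j<m. qinf (a * q ^ j) (q ^ m))"
proof (rule qinf_eqI[OF assms(1), symmetric, of _ _ "\<lambda>N. (m - 1) * N"])
  fix N
  have "m * N = N + (m - 1) * N" using assms(2) by (cases m) auto
  moreover have "feq N (\<Prod>j<m. qinf (a * q ^ j) (q ^ m)) (qpoch a q (m * N))"
    unfolding qpoch_split[OF assms(2)]
    by (intro feq_prod feq_qinf) (use assms in \<open>auto simp: fps_power_zeroth power_0_left\<close>)
  ultimately show "feq N (\<Prod>j<m. qinf (a * q ^ j) (q ^ m)) (qpoch a q (N + (m - 1) * N))"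
    by simp
qed

lemma qinf_mult_uminus:
  assumes "q $ 0 = 0"
  shows "qinf a q * qinf (- a) q = qinf (a ^ 2) (q ^ 2)"
proof (rule qinf_eqI[of _ _ _ "\<lambda>_. 0"])
  fix N
  have "qpoch a q N * qpoch (- a) q N = qpoch (a ^ 2) (q ^ 2) N"
    unfolding qpoch_def prod.distrib[symmetric]
    by (intro prod.cong refl) (simp add: power2_eq_square algebra_simps power_mult_distrib)
  then show "feq N (qinf a q * qinf (- a) q) (qpoch (a ^ 2) (q ^ 2) (N + 0))"
    using feq_mult[OF feq_qinf[OF assms order.refl, of N a] feq_qinf[OF assms order.refl, of N "-a"]]
    by simp
qed (use assms in \<open>auto simp: fps_power_zeroth\<close>)

lemma qinf_compose:
  fixes a q h :: "'a::field fps"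
  assumes "q $ 0 = 0" "h $ 0 = 0"
  shows "qinf a q oo h = qinf (a oo h) (q oo h)"
proof (rule qinf_eqI[of _ _ _ "\<lambda>_. 0"])
  fix N
  have "qpoch a q N oo h = qpoch (a oo h) (q oo h) N"
    unfolding qpoch_def using assms(2)
    by (simp add: fps_compose_prod_distrib fps_compose_sub_distrib fps_compose_mult_distrib fps_compose_power)
  then show "feq N (qinf a q oo h) (qpoch (a oo h) (q oo h) (N + 0))"
    using feq_compose[OF feq_qinf[OF assms(1) order.refl], of N a h] by simp
qed (use assms in auto)

text \<open>Only meaningful for sequences satisfying \<open>null_seq\<close> below.\<close>

definition isum :: "(nat \<Rightarrow> 'a::comm_ring_1 fps) \<Rightarrow> 'a fps" where
  "isum u = Abs_fps (\<lambda>n. \<Sum>k\<le>n. u k $ n)"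

definition null_seq :: "(nat \<Rightarrow> 'a::zero fps) \<Rightarrow> bool" where
  "null_seq u \<longleftrightarrow> (\<forall>k. feq k (u k) 0)"

lemma feq_isum:
  assumes "null_seq u" "N \<le> M"
  shows "feq N (isum u) (\<Sum>k<M. u k)"
  unfolding feq_def
proof (intro allI impI)
  fix n assume n: "n < N"
  have "(\<Sum>k<M. u k) $ n = (\<Sum>k<M. u k $ n)" by (simp add: fps_sum_nth)
  also have "\<dots> = (\<Sum>k\<le>n. u k $ n)"
    by (rule sum.mono_neutral_right) (use n assms in \<open>auto simp: null_seq_def feq_def\<close>)
  finally show "isum u $ n = (\<Sum>k<M. u k) $ n" by (simp add: isum_def)
qed

lemma isum_eqI:
  assumes "null_seq u" "\<And>N. feq N F (\<Sum>k<N. u k)"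
  shows "isum u = F"
  using feq_isum[OF assms(1) order.refl] assms(2) feq_sym feq_trans feq_eqI by metis

lemma isum_cong_feq:
  assumes "\<And>k. feq N (u k) (v k)" shows "feq N (isum u) (isum v)"
  using assms by (simp add: feq_def isum_def)

lemma null_seq_Suc: "null_seq u \<Longrightarrow> null_seq (\<lambda>k. u (Suc k))"
  by (auto simp: null_seq_def feq_def)

lemma null_seq_mult: "null_seq u \<Longrightarrow> null_seq (\<lambda>k. c * u k)"
  for u :: "nat \<Rightarrow> 'a::comm_ring_1 fps"
  unfolding null_seq_def using feq_mult[OF feq_refl[of _ c]] by (metis mult_zero_right)

lemma isum_diff: "isum (\<lambda>k. u k - v k) = isum u - isum v"
  by (simp add: isum_def fps_eq_iff sum_subtractf)

lemma isum_mult: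
  assumes "null_seq u" shows "isum (\<lambda>k. c * u k) = c * isum u"
  by (rule isum_eqI[OF null_seq_mult[OF assms]])
     (auto simp flip: sum_distrib_left intro: feq_mult feq_isum[OF assms])

lemma isum_rec:
  assumes "null_seq u" shows "isum u = u 0 + isum (\<lambda>k. u (Suc k))"
proof (rule isum_eqI[OF assms])
  fix N
  have "feq N (u 0 + isum (\<lambda>k. u (Suc k))) (u 0 + (\<Sum>k<N. u (Suc k)))"
    by (intro feq_add feq_refl feq_isum null_seq_Suc assms order.refl)
  also have "u 0 + (\<Sum>k<N. u (Suc k)) = (\<Sum>k<Suc N. u k)" by (rule sum.lessThan_Suc_shift[symmetric])
  also have "feq N (\<Sum>k<Suc N. u k) (\<Sum>k<N. u k)"
    using feq_add[OF feq_refl, of N "u N" 0 "\<Sum>k<N. u k"] assms by (simp add: null_seq_def)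
  finally show "feq N (u 0 + isum (\<lambda>k. u (Suc k))) (\<Sum>k<N. u k)" .
qed

lemma isum_compose:
  fixes u :: "nat \<Rightarrow> 'a::field fps"
  assumes "null_seq u" "h $ 0 = 0"
  shows "isum u oo h = isum (\<lambda>k. u k oo h)"
proof (rule isum_eqI[symmetric])
  show "null_seq (\<lambda>k. u k oo h)"
    using assms(1) feq_compose[of _ _ 0 h] by (auto simp: null_seq_def)
  show "feq N (isum u oo h) (\<Sum>k<N. u k oo h)" for N
    using feq_compose[OF feq_isum[OF assms(1) order.refl]] by (simp add: fps_compose_sum_distrib)
qed

lemma isum_split3:
  assumes "null_seq u"
  shows "isum u = isum (\<lambda>k. u (3 * k)) + isum (\<lambda>k. u (3 * k + 1)) + isum (\<lambda>k. u (3 * k + 2))"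
proof (rule feq_eqI)
  fix N
  have *: "null_seq (\<lambda>k. u (3 * k + j))" for j
    using assms by (auto simp: null_seq_def feq_def)
  have "(\<Sum>k<3 * N. u k) = (\<Sum>k<N. u (3 * k)) + (\<Sum>k<N. u (3 * k + 1)) + (\<Sum>k<N. u (3 * k + 2))"
    by (induction N) (auto simp: numeral_3_eq_3 algebra_simps)
  moreover have "feq N (isum u) (\<Sum>k<3 * N. u k)" by (rule feq_isum[OF assms]) simp
  moreover have "feq N (isum (\<lambda>k. u (3 * k)) + isum (\<lambda>k. u (3 * k + 1)) + isum (\<lambda>k. u (3 * k + 2)))
     ((\<Sum>k<N. u (3 * k)) + (\<Sum>k<N. u (3 * k + 1)) + (\<Sum>k<N. u (3 * k + 2)))"
    using *[of 0] *[of 1] *[of 2] by (intro feq_add feq_isum) auto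
  ultimately show "feq N (isum u) (isum (\<lambda>k. u (3 * k)) + isum (\<lambda>k. u (3 * k + 1)) + isum (\<lambda>k. u (3 * k + 2)))"
    using feq_sym feq_trans by metis
qed

section \<open>Ramanujan's bilateral summation and the triple product\<close>

text \<open>In the usual notation this is \<open>(a;q)\<^sub>n z\<^sup>n / (b;q)\<^sub>n\<close> with \<open>\<zeta> = a z\<close> and \<open>\<zeta> \<beta> = b\<close>. If moreover
  \<open>\<xi> = q / \<zeta>\<close>, then the term of index \<open>-n\<close> is \<open>hterm \<beta> \<xi> z q n\<close>, which makes the bilateral series
  \<open>Psi\<close> symmetric under exchanging \<open>(z, \<zeta>)\<close> and \<open>(\<beta>, \<xi>)\<close>.\<close>

definition hterm :: "'a::field fps \<Rightarrow> 'a fps \<Rightarrow> 'a fps \<Rightarrow> 'a fps \<Rightarrow> nat \<Rightarrow> 'a fps" where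
  "hterm z \<zeta> \<beta> q n = (\<Prod>k<n. (z - \<zeta> * q ^ k) * inverse (1 - \<zeta> * \<beta> * q ^ k))"

lemma hterm_0 [simp]: "hterm z \<zeta> \<beta> q 0 = 1"
  by (simp add: hterm_def)

lemma hterm_Suc:
  "hterm z \<zeta> \<beta> q (Suc n) = hterm z \<zeta> \<beta> q n * ((z - \<zeta> * q ^ n) * inverse (1 - \<zeta> * \<beta> * q ^ n))"
  by (simp add: hterm_def)

lemma hterm_Suc_left:
  "hterm z \<zeta> \<beta> q (Suc n) = (z - \<zeta>) * inverse (1 - \<zeta> * \<beta>) * hterm z (\<zeta> * q) \<beta> q n"
  unfolding hterm_def by (subst prod.lessThan_Suc_shift) (simp add: mult_ac)

text \<open>A factor without constant term gains one order of vanishing. Applied factor by factor,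
  this shows that the summands below form null sequences.\<close>

lemma feq_mult_0:
  fixes F G :: "'a::comm_ring_1 fps"
  assumes "feq n F 0" "G $ 0 = 0"
  shows "feq (Suc n) (F * G) 0"
  unfolding feq_def
proof (intro allI impI)
  fix k assume "k < Suc n"
  then have "F $ i * G $ (k - i) = 0" if "i \<le> k" for i
    using assms that by (cases "i = k") (auto simp: feq_def)
  then show "(F * G) $ k = 0 $ k" by (simp add: fps_mult_nth)
qed

lemma feq_mult_0': "feq n F 0 \<Longrightarrow> feq n (F * G) 0"
  for F G :: "'a::comm_ring_1 fps"
  using feq_mult[OF _ feq_refl[of n G], of F 0] by simp

text \<open>The shift to \<open>Suc n\<close> matters: the factor of index 0 has numerator
  \<open>z - \<zeta>\<close>, which may have a constant term (the value -1 for
  \<open>\<zeta>\<close> occurs later). The other \<open>n\<close> factors gain one order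
  each.\<close>

lemma null_seq_hterm_Suc:
  assumes "z $ 0 = 0" "q $ 0 = 0"
  shows "null_seq (\<lambda>n. hterm z \<zeta> \<beta> q (Suc n))"
  unfolding null_seq_def
proof
  fix n show "feq n (hterm z \<zeta> \<beta> q (Suc n)) 0"
  proof (induction n)
    case (Suc n)
    have "feq (Suc n) (hterm z \<zeta> \<beta> q (Suc n) * (z - \<zeta> * q ^ Suc n)) 0"
      by (rule feq_mult_0[OF Suc.IH]) (use assms in simp)
    then show ?case by (subst hterm_Suc) (simp add: feq_mult_0' flip: mult.assoc)
  qed (simp add: feq_def)
qed

lemma null_seq_hterm:
  assumes "z $ 0 = 0" "\<zeta> $ 0 = 0"
  shows "null_seq (hterm z \<zeta> \<beta> q)"
  unfolding null_seq_def
proof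
  fix n show "feq n (hterm z \<zeta> \<beta> q n) 0"
  proof (induction n)
    case (Suc n)
    have "feq (Suc n) (hterm z \<zeta> \<beta> q n * (z - \<zeta> * q ^ n)) 0"
      by (rule feq_mult_0[OF Suc.IH]) (use assms in simp)
    then show ?case by (subst hterm_Suc) (simp add: feq_mult_0' flip: mult.assoc)
  qed (simp add: feq_def)
qed

section \<open>Contiguous relations for the bilateral series\<close>

lemma inverse_one_minus:
  fixes F :: "'a::field fps"
  assumes "F $ 0 = 0" shows "inverse (1 - F) * (1 - F) = 1"
  using assms by (intro inverse_mult_eq_1) simp

lemma eq_mult_inverse:
  fixes h :: "'a::comm_ring_1"
  assumes "i * d = 1" "h * d = c" shows "h = c * i"
  using assms by (metis mult.assoc mult.commute mult_1_right)

text \<open>Replacing \<open>\<beta>\<close> by \<open>\<beta> * q\<close> moves all denominators up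
  by one index, so only the first and the last of them survive in the quotient.\<close>

lemma hterm_shift_aux:
  assumes "\<beta> $ 0 = 0"
  shows "hterm z \<zeta> (\<beta> * q) q n * (1 - \<zeta> * \<beta> * q ^ n) = hterm z \<zeta> \<beta> q n * (1 - \<zeta> * \<beta>)"
proof (induction n)
  case (Suc n)
  have i: "inverse (1 - \<zeta> * \<beta> * q ^ n) * (1 - \<zeta> * \<beta> * q ^ n) = 1" for n
    using assms by (intro inverse_one_minus) simp
  have "\<zeta> * (\<beta> * q) * q ^ n = \<zeta> * \<beta> * q ^ Suc n" by (simp add: mult_ac)
  then have "hterm z \<zeta> (\<beta> * q) q (Suc n) * (1 - \<zeta> * \<beta> * q ^ Suc n)
      = hterm z \<zeta> (\<beta> * q) q n * (z - \<zeta> * q ^ n) * (inverse (1 - \<zeta> * \<beta> * q ^ Suc n) * (1 - \<zeta> * \<beta> * q ^ Suc n))"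
    by (simp only: hterm_Suc mult.assoc)
  also have "\<dots> = hterm z \<zeta> \<beta> q n * (1 - \<zeta> * \<beta>) * inverse (1 - \<zeta> * \<beta> * q ^ n) * (z - \<zeta> * q ^ n)"
    unfolding i using eq_mult_inverse[OF i Suc.IH] by simp
  finally show ?case by (simp only: hterm_Suc mult_ac)
qed simp

text \<open>Over the common denominator \<open>1 - \<zeta> * \<beta> * q ^ n\<close> the terms with
  \<open>q ^ n\<close> cancel in the numerator and leave \<open>1 - z * \<beta>\<close>. The
  coefficients are independent of \<open>n\<close>, so the relation can be summed.\<close>

lemma hterm_shift:
  assumes "\<beta> $ 0 = 0"
  shows "(1 - z * \<beta>) * hterm z \<zeta> (\<beta> * q) q n
       = (1 - \<zeta> * \<beta>) * (hterm z \<zeta> \<beta> q n - \<beta> * hterm z \<zeta> \<beta> q (Suc n))"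
proof -
  define i where "i = inverse (1 - \<zeta> * \<beta> * q ^ n)"
  define h where "h = hterm z \<zeta> \<beta> q n"
  have i: "i * (1 - \<zeta> * \<beta> * q ^ n) = 1"
    unfolding i_def using assms by (intro inverse_one_minus) simp
  have "hterm z \<zeta> \<beta> q n = h * (i * (1 - \<zeta> * \<beta> * q ^ n))" by (simp add: i h_def)
  moreover have "hterm z \<zeta> \<beta> q (Suc n) = h * ((z - \<zeta> * q ^ n) * i)"
    by (simp only: hterm_Suc h_def i_def)
  moreover have "hterm z \<zeta> (\<beta> * q) q n = h * (1 - \<zeta> * \<beta>) * i"
    using eq_mult_inverse[OF i hterm_shift_aux[OF assms]] by (simp add: h_def)
  ultimately show ?thesis by (simp only: ring_distribs) (simp add: algebra_simps)
qed

text \<open>The first numerator is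
  \<open>\<beta> * q - \<xi> = \<xi> * (\<zeta> * \<beta> - 1)\<close>; each later one is
  \<open>q\<close> times the preceding numerator of \<open>hterm \<beta> \<xi> z q\<close>.\<close>

lemma hterm_shift'_aux:
  assumes "z $ 0 = 0" "q = \<zeta> * \<xi>"
  shows "hterm (\<beta> * q) \<xi> z q (Suc n) * (1 - \<xi> * z * q ^ n) = \<xi> * (\<zeta> * \<beta> - 1) * q ^ n * hterm \<beta> \<xi> z q n"
proof -
  have i: "inverse (1 - \<xi> * z * q ^ n) * (1 - \<xi> * z * q ^ n) = 1" for n
    using assms by (intro inverse_one_minus) simp
  show ?thesis
  proof (induction n)
    case 0
    show ?case using i[of 0] by (simp add: hterm_Suc assms(2) mult.assoc) (simp add: algebra_simps)
  next
    case (Suc n)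
    have "hterm (\<beta> * q) \<xi> z q (Suc (Suc n)) * (1 - \<xi> * z * q ^ Suc n)
        = hterm (\<beta> * q) \<xi> z q (Suc n) * (\<beta> * q - \<xi> * q ^ Suc n)
           * (inverse (1 - \<xi> * z * q ^ Suc n) * (1 - \<xi> * z * q ^ Suc n))"
      by (simp only: hterm_Suc[of _ _ _ _ "Suc n"] mult.assoc)
    also have "\<dots> = \<xi> * (\<zeta> * \<beta> - 1) * q ^ n * hterm \<beta> \<xi> z q n * inverse (1 - \<xi> * z * q ^ n) * (\<beta> * q - \<xi> * q ^ Suc n)"
      unfolding i using eq_mult_inverse[OF i Suc.IH] by simp
    also have "\<beta> * q - \<xi> * q ^ Suc n = q * (\<beta> - \<xi> * q ^ n)" by (simp add: algebra_simps)
    finally show ?case by (simp only: hterm_Suc[of \<beta>] power_Suc mult_ac)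
  qed
qed

text \<open>This continues \<open>hterm_shift\<close> to the terms of negative index, with the same
  coefficients.\<close>

lemma hterm_shift':
  assumes "z $ 0 = 0" "q = \<zeta> * \<xi>"
  shows "(1 - z * \<beta>) * hterm (\<beta> * q) \<xi> z q (Suc n)
       = (1 - \<zeta> * \<beta>) * (hterm \<beta> \<xi> z q (Suc n) - \<beta> * hterm \<beta> \<xi> z q n)"
proof -
  define i where "i = inverse (1 - \<xi> * z * q ^ n)"
  define h where "h = hterm \<beta> \<xi> z q n"
  have i: "i * (1 - \<xi> * z * q ^ n) = 1"
    unfolding i_def using assms by (intro inverse_one_minus) simp
  have "hterm \<beta> \<xi> z q n = h * (i * (1 - \<xi> * z * q ^ n))" by (simp add: i h_def)
  moreover have "hterm \<beta> \<xi> z q (Suc n) = h * ((\<beta> - \<xi> * q ^ n) * i)"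
    by (simp only: hterm_Suc h_def i_def)
  moreover have "hterm (\<beta> * q) \<xi> z q (Suc n) = \<xi> * (\<zeta> * \<beta> - 1) * q ^ n * h * i"
    using eq_mult_inverse[OF i hterm_shift'_aux[OF assms]] by (simp add: h_def)
  ultimately show ?thesis by (simp only: ring_distribs) (simp add: algebra_simps)
qed

definition Psi :: "'a::field fps \<Rightarrow> 'a fps \<Rightarrow> 'a fps \<Rightarrow> 'a fps \<Rightarrow> 'a fps" where
  "Psi z \<zeta> \<beta> \<xi> = 1 + isum (\<lambda>n. hterm z \<zeta> \<beta> (\<zeta> * \<xi>) (Suc n)) + isum (\<lambda>n. hterm \<beta> \<xi> z (\<zeta> * \<xi>) (Suc n))"

lemma Psi_commute: "Psi z \<zeta> \<beta> \<xi> = Psi \<beta> \<xi> z \<zeta>"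
  by (simp add: Psi_def mult.commute)

text \<open>The contiguous relations are summed over all integers. The index shift in the subtracted
  terms only reproduces the bilateral series times \<open>\<beta>\<close>, hence the factor
  \<open>1 - \<beta>\<close>.\<close>

lemma Psi_shift:
  fixes z \<zeta> \<beta> \<xi> :: "'a::field fps"
  assumes "z $ 0 = 0" "\<beta> $ 0 = 0" "(\<zeta> * \<xi>) $ 0 = 0"
  shows "(1 - z * \<beta>) * Psi z \<zeta> (\<beta> * (\<zeta> * \<xi>)) \<xi> = (1 - \<zeta> * \<beta>) * (1 - \<beta>) * Psi z \<zeta> \<beta> \<xi>"
proof -
  define q where "q = \<zeta> * \<xi>"
  have q0: "q $ 0 = 0" using assms q_def by simp
  define A where "A = isum (\<lambda>n. hterm z \<zeta> \<beta> q (Suc n))"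
  define B where "B = isum (\<lambda>n. hterm \<beta> \<xi> z q (Suc n))"
  have bq: "(\<beta> * q) $ 0 = 0" using assms by simp
  note n1 = null_seq_hterm_Suc[OF assms(1) q0]
  note n2 = null_seq_hterm_Suc[OF assms(2) q0]
  have hA: "isum (\<lambda>n. hterm z \<zeta> \<beta> q (Suc (Suc n))) = A - (z - \<zeta>) * inverse (1 - \<zeta> * \<beta>)"
    using isum_rec[OF n1, of \<zeta> \<beta>] unfolding A_def by (simp add: hterm_Suc_left[of z \<zeta> \<beta> q 0])
  have "(1 - z * \<beta>) * isum (\<lambda>n. hterm z \<zeta> (\<beta> * q) q (Suc n))
      = isum (\<lambda>n. (1 - \<zeta> * \<beta>) * (hterm z \<zeta> \<beta> q (Suc n) - \<beta> * hterm z \<zeta> \<beta> q (Suc (Suc n))))"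
    by (subst isum_mult[OF n1, symmetric]) (simp only: hterm_shift[OF assms(2)])
  also have "\<dots> = (1 - \<zeta> * \<beta>) * (A - \<beta> * (A - (z - \<zeta>) * inverse (1 - \<zeta> * \<beta>)))"
  proof -
    have "isum (\<lambda>n. (1 - \<zeta> * \<beta>) * (hterm z \<zeta> \<beta> q (Suc n) - \<beta> * hterm z \<zeta> \<beta> q (Suc (Suc n))))
        = isum (\<lambda>n. (1 - \<zeta> * \<beta>) * hterm z \<zeta> \<beta> q (Suc n) - (1 - \<zeta> * \<beta>) * \<beta> * hterm z \<zeta> \<beta> q (Suc (Suc n)))"
      by (simp add: algebra_simps)
    also have "\<dots> = (1 - \<zeta> * \<beta>) * A - (1 - \<zeta> * \<beta>) * \<beta> * isum (\<lambda>n. hterm z \<zeta> \<beta> q (Suc (Suc n)))"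
      unfolding isum_diff A_def using isum_mult[OF n1] isum_mult[OF null_seq_Suc[OF n1]] by metis
    finally show ?thesis unfolding hA by (simp add: algebra_simps)
  qed
  finally have 1: "(1 - z * \<beta>) * isum (\<lambda>n. hterm z \<zeta> (\<beta> * q) q (Suc n))
     = (1 - \<zeta> * \<beta>) * (A - \<beta> * (A - (z - \<zeta>) * inverse (1 - \<zeta> * \<beta>)))" .
  have hB: "isum (\<lambda>n. \<beta> * hterm \<beta> \<xi> z q n) = \<beta> + \<beta> * B"
  proof -
    \<comment> \<open>In the term of index \<open>n\<close> only \<open>n - 1\<close> factors are
      sure to gain an order; the factor \<open>\<beta>\<close> supplies the missing one.\<close>
    have "null_seq (\<lambda>n. \<beta> * hterm \<beta> \<xi> z q n)"
      unfolding null_seq_def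
    proof
      fix k show "feq k (\<beta> * hterm \<beta> \<xi> z q k) 0"
      proof (cases k)
        case (Suc n)
        have "feq n (hterm \<beta> \<xi> z q (Suc n)) 0" using n2[of \<xi> z] by (simp add: null_seq_def)
        from feq_mult_0[OF this assms(2)] show ?thesis by (simp add: Suc mult.commute)
      qed (simp add: feq_def)
    qed
    from isum_rec[OF this] show ?thesis unfolding B_def by (simp add: isum_mult[OF n2])
  qed
  have "(1 - z * \<beta>) * isum (\<lambda>n. hterm (\<beta> * q) \<xi> z q (Suc n))
      = isum (\<lambda>n. (1 - \<zeta> * \<beta>) * (hterm \<beta> \<xi> z q (Suc n) - \<beta> * hterm \<beta> \<xi> z q n))"
    by (subst isum_mult[OF null_seq_hterm_Suc[OF bq q0], symmetric])
       (simp only: hterm_shift'[OF assms(1) q_def])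
  also have "\<dots> = (1 - \<zeta> * \<beta>) * (B - (\<beta> + \<beta> * B))"
  proof -
    have "null_seq (\<lambda>n. hterm \<beta> \<xi> z q (Suc n) - \<beta> * hterm \<beta> \<xi> z q n)"
      unfolding null_seq_def
    proof
      fix k show "feq k (hterm \<beta> \<xi> z q (Suc k) - \<beta> * hterm \<beta> \<xi> z q k) 0"
      proof (cases k)
        case (Suc n)
        have "feq n (hterm \<beta> \<xi> z q (Suc n)) 0" using n2[of \<xi> z] by (simp add: null_seq_def)
        from feq_mult_0[OF this assms(2)] have "feq k (\<beta> * hterm \<beta> \<xi> z q k) 0"
          by (simp add: Suc mult.commute)
        moreover have "feq k (hterm \<beta> \<xi> z q (Suc k)) 0" using n2[of \<xi> z] by (simp add: null_seq_def)
        ultimately show ?thesis using feq_diff by fastforce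
      qed (simp add: feq_def)
    qed
    from isum_mult[OF this] show ?thesis unfolding isum_diff hB B_def by simp
  qed
  finally have 2: "(1 - z * \<beta>) * isum (\<lambda>n. hterm (\<beta> * q) \<xi> z q (Suc n))
     = (1 - \<zeta> * \<beta>) * (B - (\<beta> + \<beta> * B))" .
  define i where "i = inverse (1 - \<zeta> * \<beta>)"
  have i: "i * (1 - \<zeta> * \<beta>) = 1"
    unfolding i_def using assms by (intro inverse_one_minus) simp
  have "(1 - \<zeta> * \<beta>) * (A - \<beta> * (A - (z - \<zeta>) * inverse (1 - \<zeta> * \<beta>)))
      = (1 - \<zeta> * \<beta>) * (A - \<beta> * A) + \<beta> * (z - \<zeta>)"
  proof -
    have "(1 - \<zeta> * \<beta>) * (A - \<beta> * (A - (z - \<zeta>) * i))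
        = (1 - \<zeta> * \<beta>) * (A - \<beta> * A) + \<beta> * (z - \<zeta>) * (i * (1 - \<zeta> * \<beta>))"
      by (simp only: ring_distribs) (simp add: algebra_simps)
    then show ?thesis unfolding i by (simp add: i_def)
  qed
  note 1 = 1[unfolded this]
  have "(1 - z * \<beta>) * Psi z \<zeta> (\<beta> * q) \<xi> = (1 - z * \<beta>) + (1 - z * \<beta>) * isum (\<lambda>n. hterm z \<zeta> (\<beta> * q) q (Suc n))
      + (1 - z * \<beta>) * isum (\<lambda>n. hterm (\<beta> * q) \<xi> z q (Suc n))"
    unfolding Psi_def q_def[symmetric] by (simp only: distrib_left mult_1_right)
  also have "\<dots> = (1 - \<zeta> * \<beta>) * (1 - \<beta>) * (1 + A + B)"
    unfolding 1 2 by (simp add: algebra_simps)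
  finally show ?thesis
    unfolding Psi_def q_def[symmetric] A_def[symmetric] B_def[symmetric] .
qed

lemma Psi_cong_feq:
  assumes "feq N \<beta> \<beta>'" "z $ 0 = 0" "\<beta> $ 0 = 0" "\<beta>' $ 0 = 0"
  shows "feq N (Psi z \<zeta> \<beta> \<xi>) (Psi z \<zeta> \<beta>' \<xi>)"
  unfolding Psi_def hterm_def
  by (intro feq_add feq_refl isum_cong_feq feq_prod feq_mult feq_inverse feq_diff assms)
     (use assms in \<open>auto\<close>)

lemma Psi_iterate:
  fixes z \<zeta> \<beta> \<xi> :: "'a::field fps"
  assumes "z $ 0 = 0" "\<beta> $ 0 = 0" "(\<zeta> * \<xi>) $ 0 = 0"
  defines "q \<equiv> \<zeta> * \<xi>"
  shows "qpoch (z * \<beta>) q n * Psi z \<zeta> (\<beta> * q ^ n) \<xi> = qpoch (\<zeta> * \<beta>) q n * qpoch \<beta> q n * Psi z \<zeta> \<beta> \<xi>"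
proof (induction n)
  case (Suc n)
  have "(1 - z * (\<beta> * q ^ n)) * Psi z \<zeta> (\<beta> * q ^ n * q) \<xi>
      = (1 - \<zeta> * (\<beta> * q ^ n)) * (1 - \<beta> * q ^ n) * Psi z \<zeta> (\<beta> * q ^ n) \<xi>"
    unfolding q_def by (rule Psi_shift) (use assms in auto)
  moreover have "\<beta> * q ^ Suc n = \<beta> * q ^ n * q" by simp
  ultimately have "qpoch (z * \<beta>) q (Suc n) * Psi z \<zeta> (\<beta> * q ^ Suc n) \<xi>
      = (1 - \<zeta> * (\<beta> * q ^ n)) * (1 - \<beta> * q ^ n) * (qpoch (z * \<beta>) q n * Psi z \<zeta> (\<beta> * q ^ n) \<xi>)"
    by (simp add: qpoch_def mult_ac)
  also have "\<dots> = qpoch (\<zeta> * \<beta>) q (Suc n) * qpoch \<beta> q (Suc n) * Psi z \<zeta> \<beta> \<xi>"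
    unfolding Suc.IH by (simp add: qpoch_def mult_ac)
  finally show ?case .
qed (simp add: qpoch_def)

text \<open>Iterating \<open>Psi_shift\<close> replaces \<open>\<beta>\<close> by
  \<open>\<beta> * q ^ n\<close>, which tends to 0.\<close>

lemma Psi_reduce:
  fixes z \<zeta> \<beta> \<xi> :: "'a::field fps"
  assumes "z $ 0 = 0" "\<beta> $ 0 = 0" "(\<zeta> * \<xi>) $ 0 = 0"
  defines "q \<equiv> \<zeta> * \<xi>"
  shows "qinf (z * \<beta>) q * Psi z \<zeta> 0 \<xi> = qinf (\<zeta> * \<beta>) q * qinf \<beta> q * Psi z \<zeta> \<beta> \<xi>"
proof (rule feq_eqI)
  fix N
  have q0: "q $ 0 = 0" using assms by simp
  note * = feq_qinf[OF q0 order.refl, of N]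
  have "feq N (Psi z \<zeta> 0 \<xi>) (Psi z \<zeta> (\<beta> * q ^ N) \<xi>)"
    by (rule Psi_cong_feq[OF feq_sym[OF feq_power_0]]) (use q0 assms in auto)
  from feq_mult[OF * this]
  have "feq N (qinf (z * \<beta>) q * Psi z \<zeta> 0 \<xi>) (qpoch (z * \<beta>) q N * Psi z \<zeta> (\<beta> * q ^ N) \<xi>)" .
  also have "qpoch (z * \<beta>) q N * Psi z \<zeta> (\<beta> * q ^ N) \<xi> = qpoch (\<zeta> * \<beta>) q N * qpoch \<beta> q N * Psi z \<zeta> \<beta> \<xi>"
    unfolding q_def by (rule Psi_iterate) (use assms in auto)
  also have "feq N \<dots> (qinf (\<zeta> * \<beta>) q * qinf \<beta> q * Psi z \<zeta> \<beta> \<xi>)"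
    by (intro feq_mult feq_refl feq_sym[OF *])
  finally show "feq N (qinf (z * \<beta>) q * Psi z \<zeta> 0 \<xi>) (qinf (\<zeta> * \<beta>) q * qinf \<beta> q * Psi z \<zeta> \<beta> \<xi>)" .
qed

text \<open>\<open>Psi_reduce\<close> removes \<open>\<beta>\<close>, and after exchanging the two
  halves of the series it removes \<open>z\<close> as well. Together with \<open>Psi_0\<close> this
  is Ramanujan's 1psi1 summation.\<close>

lemma Psi_eq_Psi_0:
  fixes z \<zeta> \<beta> \<xi> :: "'a::field fps"
  assumes "z $ 0 = 0" "\<beta> $ 0 = 0" "(\<zeta> * \<xi>) $ 0 = 0"
  defines "q \<equiv> \<zeta> * \<xi>"
  shows "qinf (\<zeta> * \<beta>) q * qinf \<beta> q * qinf (z * \<xi>) q * qinf z q * Psi z \<zeta> \<beta> \<xi>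
       = qinf (z * \<beta>) q * Psi 0 \<zeta> 0 \<xi>"
proof -
  have "Psi 0 \<zeta> 0 \<xi> = qinf (\<xi> * z) q * qinf z q * Psi z \<zeta> 0 \<xi>"
    using Psi_reduce[of 0 z \<xi> \<zeta>] assms by (simp add: Psi_commute[of 0 \<xi> 0 \<zeta>] Psi_commute[of 0 \<xi> z \<zeta>] mult.commute)
  moreover have "qinf (z * \<beta>) q * Psi z \<zeta> 0 \<xi> = qinf (\<zeta> * \<beta>) q * qinf \<beta> q * Psi z \<zeta> \<beta> \<xi>"
    unfolding q_def by (rule Psi_reduce) (use assms in auto)
  ultimately show ?thesis by (simp add: mult_ac)
qed

text \<open>Jacobi's triple product: at \<open>z = \<zeta>\<close>, \<open>\<beta> = \<xi> q\<close> both series terminate, which pins down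
  the constant \<open>Psi 0 \<zeta> 0 \<xi>\<close>.\<close>

theorem Psi_0:
  fixes \<zeta> \<xi> :: "'a::field fps"
  assumes "\<zeta> $ 0 = 0"
  shows "Psi 0 \<zeta> 0 \<xi> = qinf \<zeta> (\<zeta> * \<xi>) * qinf \<xi> (\<zeta> * \<xi>) * qinf (\<zeta> * \<xi>) (\<zeta> * \<xi>)"
proof -
  define q where "q = \<zeta> * \<xi>"
  have q0: "q $ 0 = 0" using assms by (simp add: q_def)
  have "hterm \<zeta> \<zeta> (\<xi> * q) q (Suc n) = 0" for n
    by (simp add: hterm_Suc_left)
  \<comment> \<open>The numerator of index 1 is \<open>\<xi> * q - \<xi> * q\<close>, so this side
    contributes a single term.\<close>
  moreover have "hterm (\<xi> * q) \<xi> \<zeta> q (Suc (Suc n)) = 0" for n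
    by (simp add: hterm_Suc_left)
  moreover have "hterm (\<xi> * q) \<xi> \<zeta> q (Suc 0) = - \<xi>"
  proof -
    have "hterm (\<xi> * q) \<xi> \<zeta> q (Suc 0) = - \<xi> * (inverse (1 - q) * (1 - q))"
      unfolding hterm_Suc_left q_def[symmetric] mult.commute[of \<xi> \<zeta>] by (simp add: algebra_simps)
    then show ?thesis by (simp add: inverse_one_minus[OF q0])
  qed
  moreover have "isum (\<lambda>n. 0) = (0 :: 'a fps)"
    by (simp add: isum_def fps_eq_iff)
  ultimately have "Psi \<zeta> \<zeta> (\<xi> * q) \<xi> = 1 - \<xi>"
    using isum_rec[OF null_seq_hterm_Suc[of "\<xi> * q" q \<xi> \<zeta>]] q0
    unfolding Psi_def q_def[symmetric] by simp
  moreover have "qinf (\<zeta> * (\<xi> * q)) q * qinf (\<xi> * q) q * qinf q q * qinf \<zeta> q * Psi \<zeta> \<zeta> (\<xi> * q) \<xi>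
       = qinf (\<zeta> * (\<xi> * q)) q * Psi 0 \<zeta> 0 \<xi>"
    using Psi_eq_Psi_0[of \<zeta> "\<xi> * q" \<zeta> \<xi>] assms q0 by (simp add: q_def)
  moreover have "qinf (\<zeta> * (\<xi> * q)) q \<noteq> 0" using q0 by (intro qinf_nonzero) simp
  ultimately have "qinf (\<xi> * q) q * qinf q q * qinf \<zeta> q * (1 - \<xi>) = Psi 0 \<zeta> 0 \<xi>"
    by (simp add: mult.assoc)
  then show ?thesis
    unfolding q_def[symmetric] qinf_rec[OF q0, of \<xi>] by (simp add: mult_ac)
qed

section \<open>The even part of the mock theta function\<close>

lemma Fine_term_aux:
  assumes "\<zeta> $ 0 = 0"
  shows "hterm (z * q) (\<zeta> * q) \<beta> q n * (1 - \<zeta> * \<beta> * q ^ n) = hterm z \<zeta> \<beta> q n * ((1 - \<zeta> * \<beta>) * q ^ n)"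
proof (induction n)
  case (Suc n)
  have i: "inverse (1 - \<zeta> * \<beta> * q ^ n) * (1 - \<zeta> * \<beta> * q ^ n) = 1" for n
    using assms by (intro inverse_one_minus) simp
  have "\<zeta> * q * \<beta> * q ^ n = \<zeta> * \<beta> * q ^ Suc n" by (simp add: mult_ac)
  then have "hterm (z * q) (\<zeta> * q) \<beta> q (Suc n) * (1 - \<zeta> * \<beta> * q ^ Suc n)
      = hterm (z * q) (\<zeta> * q) \<beta> q n * (z * q - \<zeta> * q * q ^ n) * (inverse (1 - \<zeta> * \<beta> * q ^ Suc n) * (1 - \<zeta> * \<beta> * q ^ Suc n))"
    by (simp only: hterm_Suc mult.assoc)
  also have "\<dots> = hterm z \<zeta> \<beta> q n * ((1 - \<zeta> * \<beta>) * q ^ n) * inverse (1 - \<zeta> * \<beta> * q ^ n) * (z * q - \<zeta> * q * q ^ n)"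
    unfolding i using eq_mult_inverse[OF i Suc.IH] by simp
  also have "z * q - \<zeta> * q * q ^ n = q * (z - \<zeta> * q ^ n)" by (simp add: algebra_simps)
  finally show ?case by (simp only: hterm_Suc power_Suc mult_ac)
qed simp

text \<open>Over the common denominator the numerator collapses to
  \<open>- \<zeta> * q ^ n * (1 - z * \<beta>)\<close>; the factor \<open>q ^ n\<close> is absorbed
  by passing to \<open>z * q\<close> and \<open>\<zeta> * q\<close>.\<close>

lemma Fine_term:
  assumes "\<zeta> $ 0 = 0"
  shows "hterm z \<zeta> \<beta> q (Suc n) - z * hterm z \<zeta> \<beta> q n
       = - (\<zeta> * (1 - z * \<beta>) * inverse (1 - \<zeta> * \<beta>)) * hterm (z * q) (\<zeta> * q) \<beta> q n"
proof -
  define i where "i = inverse (1 - \<zeta> * \<beta> * q ^ n)"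
  define h where "h = hterm z \<zeta> \<beta> q n"
  have i: "i * (1 - \<zeta> * \<beta> * q ^ n) = 1"
    unfolding i_def using assms by (intro inverse_one_minus) simp
  have j: "inverse (1 - \<zeta> * \<beta>) * (1 - \<zeta> * \<beta>) = 1"
    using assms by (intro inverse_one_minus) simp
  have "hterm z \<zeta> \<beta> q (Suc n) - z * hterm z \<zeta> \<beta> q n = h * ((z - \<zeta> * q ^ n) * i) - z * (h * (i * (1 - \<zeta> * \<beta> * q ^ n)))"
    by (simp add: hterm_Suc h_def i) (simp add: i_def)
  also have "\<dots> = - (\<zeta> * (1 - z * \<beta>)) * (h * q ^ n * i)"
    by (simp only: ring_distribs) (simp add: algebra_simps)
  also have "\<dots> = - (\<zeta> * (1 - z * \<beta>)) * (inverse (1 - \<zeta> * \<beta>) * (1 - \<zeta> * \<beta>)) * (h * q ^ n * i)"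
    unfolding j by simp
  also have "\<dots> = - (\<zeta> * (1 - z * \<beta>) * inverse (1 - \<zeta> * \<beta>)) * (h * ((1 - \<zeta> * \<beta>) * q ^ n) * i)"
    by (simp only: mult_ac mult_minus_left mult_minus_right)
  also have "h * ((1 - \<zeta> * \<beta>) * q ^ n) * i = hterm (z * q) (\<zeta> * q) \<beta> q n"
    using eq_mult_inverse[OF i Fine_term_aux[OF assms]] by (simp add: h_def)
  finally show ?thesis .
qed

lemma Fine_rec:
  fixes z \<zeta> \<beta> q :: "'a::field fps"
  assumes "z $ 0 = 0" "\<zeta> $ 0 = 0"
  shows "(1 - z) * isum (hterm z \<zeta> \<beta> q)
       = 1 - \<zeta> * (1 - z * \<beta>) * inverse (1 - \<zeta> * \<beta>) * isum (hterm (z * q) (\<zeta> * q) \<beta> q)"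
proof -
  note n = null_seq_hterm[OF assms, of \<beta> q]
  have n': "null_seq (hterm (z * q) (\<zeta> * q) \<beta> q)"
    by (rule null_seq_hterm) (use assms in auto)
  have "(1 - z) * isum (hterm z \<zeta> \<beta> q) = isum (hterm z \<zeta> \<beta> q) - isum (\<lambda>n. z * hterm z \<zeta> \<beta> q n)"
    by (simp add: isum_mult[OF n] algebra_simps)
  also have "\<dots> = 1 + isum (\<lambda>n. hterm z \<zeta> \<beta> q (Suc n) - z * hterm z \<zeta> \<beta> q n)"
    by (subst isum_rec[OF n]) (simp add: isum_diff)
  also have "isum (\<lambda>n. hterm z \<zeta> \<beta> q (Suc n) - z * hterm z \<zeta> \<beta> q n)
     = - (\<zeta> * (1 - z * \<beta>) * inverse (1 - \<zeta> * \<beta>)) * isum (hterm (z * q) (\<zeta> * q) \<beta> q)"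
    unfolding Fine_term[OF assms(2)] by (rule isum_mult[OF n'])
  finally show ?thesis by simp
qed

text \<open>General term produced by iterating \<open>Fine_rec\<close>: the first product collects
  the coefficients of the recursion, the second the divisions by
  \<open>1 - z * q ^ k\<close>.\<close>

definition fine_term :: "'a::field fps \<Rightarrow> 'a fps \<Rightarrow> 'a fps \<Rightarrow> 'a fps \<Rightarrow> nat \<Rightarrow> 'a fps" where
  "fine_term z \<zeta> \<beta> q n = (\<Prod>k<n. - (\<zeta> * q ^ k) * (1 - z * \<beta> * q ^ k) * inverse (1 - \<zeta> * \<beta> * q ^ k))
     * (\<Prod>k<Suc n. inverse (1 - z * q ^ k))"

theorem Fine_transformation:
  fixes z \<zeta> \<beta> q :: "'a::field fps"
  assumes "z $ 0 = 0" "\<zeta> $ 0 = 0"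
  shows "isum (hterm z \<zeta> \<beta> q) = isum (fine_term z \<zeta> \<beta> q)"
proof -
  define P where "P N = (\<Prod>k<N. - (\<zeta> * q ^ k) * (1 - z * \<beta> * q ^ k) * inverse (1 - \<zeta> * \<beta> * q ^ k))
     * (\<Prod>k<N. inverse (1 - z * q ^ k))" for N
  define H where "H N = isum (hterm (z * q ^ N) (\<zeta> * q ^ N) \<beta> q)" for N
  have P_Suc: "P (Suc N) = P N * (- (\<zeta> * q ^ N) * (1 - z * \<beta> * q ^ N) * inverse (1 - \<zeta> * \<beta> * q ^ N) * inverse (1 - z * q ^ N))" for N
    by (simp add: P_def mult_ac)
  have P_null: "feq N (P N) 0" for N
  proof (induction N)
    case (Suc N)
    show ?case unfolding P_Suc by (rule feq_mult_0[OF Suc.IH]) (use assms in simp)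
  qed (simp add: feq_def)
  have fine: "fine_term z \<zeta> \<beta> q N = P N * inverse (1 - z * q ^ N)" for N
    by (simp add: fine_term_def P_def mult_ac)
  have null: "null_seq (fine_term z \<zeta> \<beta> q)"
    unfolding null_seq_def fine using P_null feq_mult_0' by blast
  \<comment> \<open>\<open>P N * H N\<close> is the remainder after \<open>N\<close> iterations.
    Every factor of \<open>P N\<close> contains \<open>\<zeta>\<close>, so the remainder vanishes to
    order \<open>N\<close>.\<close>
  have step: "H 0 = (\<Sum>n<N. fine_term z \<zeta> \<beta> q n) + P N * H N" for N
  proof (induction N)
    case (Suc N)
    have i: "inverse (1 - z * q ^ N) * (1 - z * q ^ N) = 1"
      using assms by (intro inverse_one_minus) simp
    have "H N * (1 - z * q ^ N) = 1 + (- (\<zeta> * q ^ N) * (1 - z * \<beta> * q ^ N) * inverse (1 - \<zeta> * \<beta> * q ^ N)) * H (Suc N)"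
      unfolding H_def using Fine_rec[of "z * q ^ N" "\<zeta> * q ^ N" \<beta> q] assms by (simp add: mult_ac)
    from eq_mult_inverse[OF i this]
    have "P N * H N = fine_term z \<zeta> \<beta> q N + P (Suc N) * H (Suc N)"
      unfolding fine P_Suc by (simp only: ring_distribs mult_ac mult_1_right mult_1_left)
    with Suc show ?case by simp
  qed (simp add: P_def)
  have "isum (fine_term z \<zeta> \<beta> q) = H 0"
  proof (rule isum_eqI[OF null])
    fix N
    have "feq N ((\<Sum>n<N. fine_term z \<zeta> \<beta> q n) + P N * H N) ((\<Sum>n<N. fine_term z \<zeta> \<beta> q n) + 0)"
      by (intro feq_add feq_refl feq_mult_0' P_null)
    then show "feq N (H 0) (\<Sum>n<N. fine_term z \<zeta> \<beta> q n)"
      by (subst step[of N]) simp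
  qed
  then show ?thesis by (simp add: H_def)
qed

abbreviation "X \<equiv> (fps_X :: rat fps)"

definition beta :: "rat fps" where
  "beta = isum beta_term"

lemma beta_nth: "beta $ m = frakb m"
  by (simp add: beta_def isum_def frakb_def)

text \<open>In base \<open>X ^ 2\<close> the denominators on the right are (q^3;q^2)_n and
  (q;q^2)_(n+1), whereas \<open>beta_term\<close> has the square of the latter; this explains the
  factor \<open>1 - X\<close>.\<close>

lemma beta_term_eq_fine_term: "(1 - X) * beta_term n = fine_term X (- (X ^ 2)) (- X) (X ^ 2) n"
proof (induction n)
  case 0
  have "inverse (1 - X) * (1 - X) = 1" by (intro inverse_one_minus) simp
  then show ?case
    by (simp add: beta_term_def fine_term_def qpoch_def power2_eq_square fps_inverse_mult mult_ac)
next
  case (Suc n)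
  have 1: "beta_term (Suc n) = beta_term n * (X ^ 2 * (X ^ 2) ^ n * (1 + X ^ 2 * (X ^ 2) ^ n)
           * (inverse (1 - X * (X ^ 2) ^ Suc n) * inverse (1 - X * (X ^ 2) ^ Suc n)))"
  proof -
    have "X ^ (Suc n * (Suc n + 1)) = X ^ (n * (n + 1)) * (X ^ 2 * (X ^ 2) ^ n)"
      by (simp flip: power_mult power_add add: algebra_simps)
    then show ?thesis unfolding beta_term_def qpoch_def
      by (simp add: power2_eq_square fps_inverse_mult mult_ac)
  qed
  have 2: "fine_term X (- (X ^ 2)) (- X) (X ^ 2) (Suc n) = fine_term X (- (X ^ 2)) (- X) (X ^ 2) n *
    (X ^ 2 * (X ^ 2) ^ n * (1 + X ^ 2 * (X ^ 2) ^ n)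
           * (inverse (1 - X * (X ^ 2) ^ Suc n) * inverse (1 - X * (X ^ 2) ^ Suc n)))"
  proof -
    have "- (- (X ^ 2)) * (X ^ 2) ^ n = X ^ 2 * (X ^ 2) ^ n"
         "1 - X * (- X) * (X ^ 2) ^ n = 1 + X ^ 2 * (X ^ 2) ^ n"
         "1 - - (X ^ 2) * (- X) * (X ^ 2) ^ n = 1 - X * (X ^ 2) ^ Suc n"
      by (simp_all add: power2_eq_square mult_ac)
    then show ?thesis unfolding fine_term_def prod.lessThan_Suc
      by (simp add: mult_ac)
  qed
  show ?case unfolding 1 2 Suc.IH[symmetric] by (simp only: mult_ac)
qed

lemma null_seq_beta_term: "null_seq beta_term"
  unfolding null_seq_def
proof
  fix k
  have "feq k (1 * X ^ (k * (k + 1))) 0" by (rule feq_power_0) auto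
  then show "feq k (beta_term k) 0"
    unfolding beta_term_def mult.assoc by (intro feq_mult_0') simp
qed

lemma beta_eq_hterm_sum: "(1 - X) * beta = isum (hterm X (- (X ^ 2)) (- X) (X ^ 2))"
proof -
  have "(1 - X) * beta = isum (\<lambda>n. (1 - X) * beta_term n)"
    unfolding beta_def by (rule isum_mult[OF null_seq_beta_term, symmetric])
  also have "\<dots> = isum (fine_term X (- (X ^ 2)) (- X) (X ^ 2))"
    by (simp only: beta_term_eq_fine_term)
  also have "\<dots> = isum (hterm X (- (X ^ 2)) (- X) (X ^ 2))"
    by (rule Fine_transformation[symmetric]) auto
  finally show ?thesis .
qed

lemma hterm_compose:
  assumes "h $ 0 = 0" "\<zeta> $ 0 = 0"
  shows "hterm z \<zeta> \<beta> q n oo h = hterm (z oo h) (\<zeta> oo h) (\<beta> oo h) (q oo h) n"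
proof -
  have "inverse (1 - \<zeta> * \<beta> * q ^ k) oo h = inverse (1 - (\<zeta> oo h) * (\<beta> oo h) * (q oo h) ^ k)" for k
    using assms by (subst fps_inverse_compose)
      (auto simp: fps_compose_sub_distrib fps_compose_mult_distrib fps_compose_power)
  then show ?thesis
    unfolding hterm_def using assms
    by (simp add: fps_compose_prod_distrib fps_compose_sub_distrib fps_compose_mult_distrib fps_compose_power)
qed

text \<open>The terms of negative index of the bilateral series are those of \<open>\<beta>(-q)\<close>.\<close>

lemma Psi_beta: "Psi X (- (X ^ 2)) (- X) (- 1) = (1 - X) * (beta + (beta oo - X))"
proof -
  have q: "- (X ^ 2) * - 1 = X ^ 2" by simp
  have n: "null_seq (hterm X (- (X ^ 2)) (- X) (X ^ 2))" "null_seq (hterm (- X) (- (X ^ 2)) X (X ^ 2))"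
    by (rule null_seq_hterm; simp)+
  have c: "hterm X (- (X ^ 2)) (- X) (X ^ 2) n oo - X = hterm (- X) (- (X ^ 2)) X (X ^ 2) n" for n
    by (subst hterm_compose) (auto simp: fps_compose_uminus simp flip: fps_compose_power)
  have "(1 + X) * (beta oo - X) = ((1 - X) * beta) oo - X"
    by (simp add: fps_compose_mult_distrib fps_compose_sub_distrib)
  also have "\<dots> = isum (hterm (- X) (- (X ^ 2)) X (X ^ 2))"
    unfolding beta_eq_hterm_sum by (subst isum_compose[OF n(1)]) (auto simp: c)
  finally have 1: "(1 + X) * (beta oo - X) = isum (hterm (- X) (- (X ^ 2)) X (X ^ 2))" .
  have i: "inverse (1 + X) * (1 + X) = 1"
    using inverse_one_minus[of "- X"] by simp
  have "hterm (- X) (- 1) X (X ^ 2) (Suc n) = (1 - X) * inverse (1 + X) * hterm (- X) (- (X ^ 2)) X (X ^ 2) n" for n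
    by (simp add: hterm_Suc_left)
  then have "isum (\<lambda>n. hterm (- X) (- 1) X (X ^ 2) (Suc n)) = (1 - X) * inverse (1 + X) * ((1 + X) * (beta oo - X))"
    unfolding 1 by (simp only: isum_mult[OF n(2)])
  also have "\<dots> = (1 - X) * (inverse (1 + X) * (1 + X)) * (beta oo - X)" by (simp only: mult_ac)
  finally have 2: "isum (\<lambda>n. hterm (- X) (- 1) X (X ^ 2) (Suc n)) = (1 - X) * (beta oo - X)"
    unfolding i by simp
  have "Psi X (- (X ^ 2)) (- X) (- 1) = (1 + isum (\<lambda>n. hterm X (- (X ^ 2)) (- X) (X ^ 2) (Suc n))) + (1 - X) * (beta oo - X)"
    unfolding Psi_def q 2 ..
  also have "1 + isum (\<lambda>n. hterm X (- (X ^ 2)) (- X) (X ^ 2) (Suc n)) = (1 - X) * beta"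
    unfolding beta_eq_hterm_sum using isum_rec[OF n(1)] by simp
  finally show ?thesis by (simp add: algebra_simps)
qed

lemma fps_compose_X_power_nth:
  fixes F :: "'a::comm_ring_1 fps"
  assumes "m > 0"
  shows "(F oo fps_X ^ m) $ n = (if m dvd n then F $ (n div m) else 0)"
proof -
  have *: "(fps_X ^ m) ^ i $ n = (if n = m * i then 1 else 0 :: 'a)" for i
    by (simp flip: power_mult)
  have "(F oo fps_X ^ m) $ n = (\<Sum>i\<in>{0..n}. if n = m * i then F $ i else 0)"
    unfolding fps_compose_nth * by (intro sum.cong) auto
  also have "\<dots> = (\<Sum>i\<in>{i\<in>{0..n}. n = m * i}. F $ i)"
    by (rule sum.inter_filter[symmetric]) auto
  also have "{i\<in>{0..n}. n = m * i} = (if m dvd n then {n div m} else {})"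
    using assms by (auto simp: dvd_def)
  finally show ?thesis by simp
qed

definition even_part :: "rat fps" where
  "even_part = Abs_fps (\<lambda>n. frakb (2 * n))"

lemma even_part_compose: "2 * (even_part oo X ^ 2) = beta + (beta oo - X)"
proof (rule fps_ext)
  fix n
  have "(2 * (even_part oo X ^ 2)) $ n = 2 * (even_part oo X ^ 2) $ n"
    by (simp add: numeral_fps_const)
  also have "\<dots> = frakb n + (- 1) ^ n * frakb n"
    by (cases "even n") (auto simp: fps_compose_X_power_nth even_part_def)
  finally show "(2 * (even_part oo X ^ 2)) $ n = (beta + (beta oo - X)) $ n"
    by (simp add: beta_nth fps_compose_uminus')
qed

lemma compose_X_power_inj:
  fixes F G :: "'a::comm_ring_1 fps"
  assumes "m > 0" "F oo fps_X ^ m = G oo fps_X ^ m"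
  shows "F = G"
proof (rule fps_ext)
  fix n
  have "(F oo fps_X ^ m) $ (m * n) = (G oo fps_X ^ m) $ (m * n)" using assms by simp
  then show "F $ n = G $ n" using assms(1) by (simp add: fps_compose_X_power_nth)
qed

text \<open>Ramanujan's summation evaluates the series in \<open>Psi_beta\<close>. Once the products
  at \<open>X\<close> and \<open>- X\<close> are paired, only series in \<open>X ^ 2\<close> remain,
  and \<open>X ^ 2\<close> may be replaced by \<open>X\<close>.\<close>

lemma even_part_product: "even_part * qinf X (X ^ 2) ^ 2 = qinf (- X) X ^ 3 * qinf X X"
proof (rule compose_X_power_inj[of 2])
  have q: "- (X ^ 2) * - 1 = X ^ 2" by simp
  have "qinf (- (X ^ 2) * - X) (X ^ 2) * qinf (- X) (X ^ 2) * qinf (X * - 1) (X ^ 2) * qinf X (X ^ 2) * Psi X (- (X ^ 2)) (- X) (- 1)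
      = qinf (X * - X) (X ^ 2) * Psi 0 (- (X ^ 2)) 0 (- 1)"
    using Psi_eq_Psi_0[of X "- X" "- (X ^ 2)" "- 1"] unfolding q by simp
  also have "Psi 0 (- (X ^ 2)) 0 (- 1) = qinf (- (X ^ 2)) (X ^ 2) * qinf (- 1) (X ^ 2) * qinf (X ^ 2) (X ^ 2)"
    using Psi_0[of "- (X ^ 2)" "- 1"] unfolding q by simp
  \<comment> \<open>The factor of index 0 equals 2; it cancels the 2 of
    \<open>even_part_compose\<close>.\<close>
  also have "qinf (- 1) (X ^ 2) = 2 * qinf (- (X ^ 2)) (X ^ 2)"
    by (subst qinf_rec) auto
  finally have 1: "qinf (X * X ^ 2) (X ^ 2) * qinf (- X) (X ^ 2) * qinf (- X) (X ^ 2) * qinf X (X ^ 2)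
       * ((1 - X) * (2 * (even_part oo X ^ 2))) = 2 * (qinf (- (X ^ 2)) (X ^ 2) ^ 3 * qinf (X ^ 2) (X ^ 2))"
    unfolding Psi_beta even_part_compose by (simp add: power3_eq_cube power2_eq_square mult_ac)
  \<comment> \<open>\<open>1 - X\<close> is the leading factor that
    \<open>qinf (X * X ^ 2) (X ^ 2)\<close> lacks.\<close>
  have "2 * ((even_part oo X ^ 2) * (qinf X (X ^ 2) * qinf (- X) (X ^ 2)) ^ 2)
      = qinf (X * X ^ 2) (X ^ 2) * qinf (- X) (X ^ 2) * qinf (- X) (X ^ 2) * qinf X (X ^ 2)
       * ((1 - X) * (2 * (even_part oo X ^ 2)))"
    using qinf_rec[of "X ^ 2" X] by (simp add: power2_eq_square mult_ac)
  also note 1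
  also have "qinf X (X ^ 2) * qinf (- X) (X ^ 2) = qinf (X ^ 2) ((X ^ 2) ^ 2)"
    by (rule qinf_mult_uminus) simp
  finally have "(even_part oo X ^ 2) * qinf (X ^ 2) ((X ^ 2) ^ 2) ^ 2 = qinf (- (X ^ 2)) (X ^ 2) ^ 3 * qinf (X ^ 2) (X ^ 2)"
    by simp
  then show "even_part * qinf X (X ^ 2) ^ 2 oo X ^ 2 = qinf (- X) X ^ 3 * qinf X X oo X ^ 2"
    by (simp add: fps_compose_mult_distrib qinf_compose fps_compose_uminus flip: fps_compose_power)
qed simp

abbreviation J :: "nat \<Rightarrow> rat fps" where
  "J m \<equiv> qinf (X ^ m) (X ^ m)"

abbreviation E :: "rat fps \<Rightarrow> rat fps" where
  "E F \<equiv> F oo X ^ 3"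

lemma X_power_compose: "m > 0 \<Longrightarrow> X ^ n oo X ^ m = X ^ (m * n)"
  by (simp flip: fps_compose_power add: power_mult)

lemma E_J: "m > 0 \<Longrightarrow> E (J m) = J (3 * m)"
  by (simp add: qinf_compose X_power_compose)

lemma J_nth_0: "m > 0 \<Longrightarrow> J m $ 0 = 1"
  by (simp add: qinf_nth_0)

lemma J_nonzero: "m > 0 \<Longrightarrow> J m \<noteq> 0"
  by (simp add: qinf_nonzero)

lemma qinf_X_odd: "qinf X (X ^ 2) * J 2 = J 1"
  using qinf_split[of X 2 X] by (simp add: numeral_2_eq_2)

lemma qinf_minus_X: "qinf (- X) X * J 1 = J 2"
  using qinf_mult_uminus[of X X] by (simp add: mult.commute)

theorem even_part_eta: "even_part * J 1 ^ 4 = J 2 ^ 5"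
proof -
  have "even_part * J 1 ^ 4 = even_part * (qinf X (X ^ 2) * J 2) ^ 2 * J 1 ^ 2"
    unfolding qinf_X_odd by (simp add: power2_eq_square power4_eq_xxxx mult_ac)
  also have "\<dots> = (even_part * qinf X (X ^ 2) ^ 2) * J 2 ^ 2 * J 1 ^ 2"
    by (simp add: power_mult_distrib mult_ac)
  also have "\<dots> = (qinf (- X) X * J 1) ^ 3 * J 2 ^ 2"
    unfolding even_part_product by (simp add: power2_eq_square power3_eq_cube mult_ac)
  finally show ?thesis unfolding qinf_minus_X by (simp flip: power_add)
qed

section \<open>Theta functions and their 3-dissections\<close>

definition tri :: "nat \<Rightarrow> nat" where
  "tri n = (\<Sum>k<n. k)"

lemma tri_0 [simp]: "tri 0 = 0" and tri_Suc [simp]: "tri (Suc n) = tri n + n"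
  by (simp_all add: tri_def)

lemma two_tri: "2 * tri n + n = n * n"
  by (induction n) auto

lemma hterm_0_0: "hterm 0 \<zeta> 0 q n = (- \<zeta>) ^ n * q ^ tri n"
  by (induction n) (auto simp: hterm_Suc power_add mult_ac)

lemma Psi_0_series:
  "Psi 0 \<zeta> 0 \<xi> = 1 + isum (\<lambda>n. (- \<zeta>) ^ Suc n * (\<zeta> * \<xi>) ^ tri (Suc n))
                 + isum (\<lambda>n. (- \<xi>) ^ Suc n * (\<zeta> * \<xi>) ^ tri (Suc n))"
  unfolding Psi_def hterm_0_0 ..

lemma null_seq_X_power: "(\<And>n. n \<le> e n) \<Longrightarrow> null_seq (\<lambda>n. c n * X ^ e n)"
  unfolding null_seq_def by (auto intro!: feq_power_0)

lemma null_seq_X_power': "(\<And>n. n \<le> e n) \<Longrightarrow> null_seq (\<lambda>n. X ^ e n)"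
  using null_seq_X_power[of e "\<lambda>_. 1"] by simp

lemma E_isum_X_power: "(\<And>n. n \<le> e n) \<Longrightarrow> E (isum (\<lambda>n. X ^ e n)) = isum (\<lambda>n. X ^ (3 * e n))"
  by (subst isum_compose[OF null_seq_X_power']) (simp_all add: X_power_compose)

lemma E_isum_sign: "(\<And>n. n \<le> e n) \<Longrightarrow> E (isum (\<lambda>n. (- 1) ^ n * X ^ e n)) = isum (\<lambda>n. (- 1) ^ n * X ^ (3 * e n))"
  by (subst isum_compose[OF null_seq_X_power])
     (simp_all add: fps_compose_mult_distrib power_mult fps_compose_uminus flip: fps_compose_power)

text \<open>Here \<open>phi\<close> is \<open>\<phi>(-q)\<close>, and in Ramanujan's notation \<open>psi3\<close> is \<open>f(q,q\<^sup>2)\<close> and \<open>phi3\<close> is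
  \<open>f(-q,-q\<^sup>5)\<close>.\<close>

definition psi :: "rat fps" where
  "psi = isum (\<lambda>n. X ^ tri (Suc n))"

definition phi :: "rat fps" where
  "phi = 2 * isum (\<lambda>n. (- 1) ^ n * X ^ (n * n)) - 1"

definition psi3 :: "rat fps" where
  "psi3 = isum (\<lambda>n. X ^ (2 * n + 3 * tri n)) + isum (\<lambda>n. X ^ (Suc n + 3 * tri (Suc n)))"

definition phi3 :: "rat fps" where
  "phi3 = isum (\<lambda>n. (- 1) ^ n * X ^ (5 * n + 6 * tri n)) - isum (\<lambda>n. (- 1) ^ n * X ^ (Suc n + 6 * tri (Suc n)))"

lemma n_le_tri_Suc: "n \<le> tri (Suc n)" by simp

text \<open>Triple product at \<open>\<zeta> = - X\<close>, \<open>\<xi> = - 1\<close>: the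
  bilateral series meets every exponent twice, matching the factor 2 in
  \<open>qinf (- 1) X\<close>.\<close>

lemma psi_eta: "psi * J 1 = J 2 ^ 2"
proof -
  note n = null_seq_X_power'[of "\<lambda>n. tri (Suc n)", OF n_le_tri_Suc]
  have "X ^ Suc n * X ^ tri (Suc n) = X ^ tri (Suc (Suc n))" for n
    by (simp flip: power_add add: add_ac)
  then have "Psi 0 (- X) 0 (- 1) = 1 + isum (\<lambda>n. X ^ tri (Suc (Suc n))) + isum (\<lambda>n. X ^ tri (Suc n))"
    unfolding Psi_0_series by (simp del: tri_Suc)
  also have "1 + isum (\<lambda>n. X ^ tri (Suc (Suc n))) = psi"
    unfolding psi_def using isum_rec[OF n] by simp
  also have "psi + isum (\<lambda>n. X ^ tri (Suc n)) = 2 * psi" by (simp add: psi_def)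
  finally have "2 * psi = qinf (- X) X * qinf (- 1) X * qinf X X"
    using Psi_0[of "- X" "- 1"] by simp
  also have "qinf (- 1) X = 2 * qinf (- X) X" by (subst qinf_rec) auto
  finally have "psi = qinf (- X) X ^ 2 * J 1" by (simp add: power2_eq_square mult_ac)
  then have "psi * J 1 = (qinf (- X) X * J 1) ^ 2" by (simp add: power2_eq_square mult_ac)
  then show ?thesis unfolding qinf_minus_X .
qed

text \<open>Triple product at \<open>\<zeta> = \<xi> = X\<close>, where both halves of the series
  agree.\<close>

lemma phi_eta: "phi * J 2 = J 1 ^ 2"
proof -
  have n: "null_seq (\<lambda>n. (- 1) ^ n * X ^ (n * n))" by (rule null_seq_X_power) simp
  have "(- X) ^ Suc n * (X * X) ^ tri (Suc n) = (- 1) ^ Suc n * X ^ (Suc n * Suc n)" for n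
  proof -
    have "(- X) ^ Suc n = (- 1) ^ Suc n * X ^ Suc n" by (rule power_minus)
    moreover have "(X * X) ^ tri (Suc n) = X ^ (2 * tri (Suc n))"
      by (simp only: power_mult power2_eq_square)
    ultimately show ?thesis using two_tri[of "Suc n"]
      by (simp only: mult.assoc flip: power_add) (simp only: add.commute)
  qed
  then have "Psi 0 X 0 X = 1 + 2 * isum (\<lambda>n. (- 1) ^ Suc n * X ^ (Suc n * Suc n))"
    unfolding Psi_0_series by (simp only: mult_2 add.assoc)
  also have "\<dots> = phi"
    unfolding phi_def using isum_rec[OF n] by simp
  finally have "phi = qinf X (X ^ 2) * qinf X (X ^ 2) * J 2"
    using Psi_0[of X X] by (simp add: power2_eq_square)
  then have "phi * J 2 = (qinf X (X ^ 2) * J 2) ^ 2" by (simp add: power2_eq_square mult_ac)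
  then show ?thesis unfolding qinf_X_odd .
qed

text \<open>Triple product at \<open>\<zeta> = - (X ^ 2)\<close>, \<open>\<xi> = - X\<close>; its
  two factors are what remains of \<open>qinf (- X) X\<close> when the exponents divisible by 3 are
  removed.\<close>

lemma psi3_eta: "psi3 * J 1 * J 6 = J 2 * J 3 ^ 2"
proof -
  have q: "- (X ^ 2) * - X = X ^ 3" by (simp add: power2_eq_square power3_eq_cube)
  have n: "null_seq (\<lambda>n. X ^ (2 * n + 3 * tri n))" by (rule null_seq_X_power') simp
  have "Psi 0 (- (X ^ 2)) 0 (- X) = 1 + isum (\<lambda>n. X ^ (2 * Suc n + 3 * tri (Suc n))) + isum (\<lambda>n. X ^ (Suc n + 3 * tri (Suc n)))"
    unfolding Psi_0_series q by (simp only: minus_minus power_add power_mult)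
  also have "\<dots> = psi3"
    unfolding psi3_def using isum_rec[OF n] by simp
  finally have 1: "psi3 = qinf (- (X ^ 2)) (X ^ 3) * qinf (- X) (X ^ 3) * J 3"
    using Psi_0[of "- (X ^ 2)" "- X"] unfolding q by simp
  have 2: "qinf (- X) X = qinf (- X) (X ^ 3) * qinf (- (X ^ 2)) (X ^ 3) * qinf (- (X ^ 3)) (X ^ 3)"
    using qinf_split[of X 3 "- X"] by (simp add: numeral_3_eq_3 power2_eq_square mult.assoc)
  have 3: "qinf (- (X ^ 3)) (X ^ 3) * J 3 = J 6"
    using qinf_mult_uminus[of "X ^ 3" "X ^ 3"] by (simp add: mult.commute flip: power_mult)
  have "psi3 * J 1 * J 6 = (qinf (- X) X * J 1) * J 3 ^ 2"
    unfolding 1 2 3[symmetric] by (simp add: power2_eq_square mult_ac)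
  then show ?thesis unfolding qinf_minus_X .
qed

text \<open>Triple product at \<open>\<zeta> = X ^ 5\<close>, \<open>\<xi> = X\<close>; here the odd
  exponents are split into the classes 1, 3, 5 modulo 6.\<close>

lemma phi3_eta: "phi3 * J 2 * J 3 = J 1 * J 6 ^ 2"
proof -
  have q: "X ^ 5 * X = X ^ 6" by (simp flip: power_Suc2)
  have n: "null_seq (\<lambda>n. (- 1) ^ n * X ^ (5 * n + 6 * tri n))" by (rule null_seq_X_power) simp
  have "Psi 0 (X ^ 5) 0 X = 1 + isum (\<lambda>n. (- 1) ^ Suc n * X ^ (5 * Suc n + 6 * tri (Suc n)))
      + isum (\<lambda>n. (- 1) ^ Suc n * X ^ (Suc n + 6 * tri (Suc n)))"
    unfolding Psi_0_series q power_minus[of "X ^ 5"] power_minus[of X] by (simp only: power_add power_mult mult.assoc)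
  also have "isum (\<lambda>n. (- 1) ^ Suc n * X ^ (Suc n + 6 * tri (Suc n)))
      = isum (\<lambda>n. (- 1) * ((- 1) ^ n * X ^ (Suc n + 6 * tri (Suc n))))" by (simp only: power_Suc mult.assoc)
  also have "\<dots> = - isum (\<lambda>n. (- 1) ^ n * X ^ (Suc n + 6 * tri (Suc n)))"
    by (subst isum_mult[OF null_seq_X_power]) auto
  also have "1 + isum (\<lambda>n. (- 1) ^ Suc n * X ^ (5 * Suc n + 6 * tri (Suc n))) = isum (\<lambda>n. (- 1) ^ n * X ^ (5 * n + 6 * tri n))"
    using isum_rec[OF n] by simp
  finally have 1: "phi3 = qinf (X ^ 5) (X ^ 6) * qinf X (X ^ 6) * J 6"
    using Psi_0[of "X ^ 5" X] unfolding q by (simp add: phi3_def)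
  have 2: "qinf X (X ^ 2) = qinf X (X ^ 6) * qinf (X ^ 3) (X ^ 6) * qinf (X ^ 5) (X ^ 6)"
    using qinf_split[of "X ^ 2" 3 X] by (simp add: numeral_3_eq_3 mult.assoc flip: power_mult power_Suc) (simp add: eval_nat_numeral)
  have 3: "qinf (X ^ 3) (X ^ 6) * J 6 = J 3"
    using arg_cong[OF qinf_X_odd, of E] by (simp add: fps_compose_mult_distrib qinf_compose X_power_compose)
  have "phi3 * J 2 * J 3 = (qinf X (X ^ 2) * J 2) * J 6 ^ 2"
    unfolding 1 2 3[symmetric] by (simp add: power2_eq_square mult_ac)
  then show ?thesis unfolding qinf_X_odd .
qed

text \<open>The triangular number \<open>k(k+1)/2\<close> is divisible by 3 unless \<open>k\<close>
  is 1 modulo 3, when it is 1 plus 9 times a triangular number.\<close>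

lemma psi_dissection: "psi = E psi3 + X * E (E psi)"
proof -
  note n = null_seq_X_power'[of "\<lambda>n. tri (Suc n)", OF n_le_tri_Suc]
  have t: "tri (Suc (3 * k)) = 3 * (2 * k + 3 * tri k)"
          "tri (Suc (3 * k + 1)) = 1 + 3 * (3 * tri (Suc k))"
          "tri (Suc (3 * k + 2)) = 3 * (Suc k + 3 * tri (Suc k))" for k
    using two_tri[of "Suc (3 * k)"] two_tri[of "Suc (3 * k + 1)"] two_tri[of "Suc (3 * k + 2)"] two_tri[of k]
    by (simp_all add: algebra_simps)
  have "psi = isum (\<lambda>k. X ^ (3 * (2 * k + 3 * tri k))) + isum (\<lambda>k. X * X ^ (3 * (3 * tri (Suc k))))
       + isum (\<lambda>k. X ^ (3 * (Suc k + 3 * tri (Suc k))))"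
    unfolding psi_def by (subst isum_split3[OF n]) (simp only: t power_add power_one_right)
  also have "isum (\<lambda>k. X * X ^ (3 * (3 * tri (Suc k)))) = X * isum (\<lambda>k. X ^ (3 * (3 * tri (Suc k))))"
    by (rule isum_mult[OF null_seq_X_power']) simp
  also have "isum (\<lambda>k. X ^ (3 * (3 * tri (Suc k)))) = E (E psi)"
    unfolding psi_def by (simp add: E_isum_X_power del: tri_Suc)
       (subst E_isum_X_power, simp_all)+
  also have "isum (\<lambda>k. X ^ (3 * (2 * k + 3 * tri k))) + X * E (E psi) + isum (\<lambda>k. X ^ (3 * (Suc k + 3 * tri (Suc k))))
     = E psi3 + X * E (E psi)"
    unfolding psi3_def fps_compose_add_distrib by (subst (1 2) E_isum_X_power) auto
  finally show ?thesis .
qed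

text \<open>Squares of multiples of 3 are 9 times squares; all others are 1 modulo 3. The two
  nonzero classes carry opposite signs, which gives the difference in \<open>phi3\<close>.\<close>

lemma phi_dissection: "phi = E (E phi) - 2 * X * E phi3"
proof -
  have n: "null_seq (\<lambda>n. (- 1) ^ n * X ^ (n * n))" by (rule null_seq_X_power) simp
  have e: "3 * k * (3 * k) = 3 * (3 * (k * k))"
          "(3 * k + 1) * (3 * k + 1) = Suc (3 * (5 * k + 6 * tri k))"
          "(3 * k + 2) * (3 * k + 2) = Suc (3 * (Suc k + 6 * tri (Suc k)))" for k
    using two_tri[of k] by (simp_all add: algebra_simps)
  have s: "(- 1) ^ (3 * k) = ((- 1) ^ k :: rat fps)" for k
    by (simp add: power_mult)
  define v where "v = isum (\<lambda>n. (- 1) ^ n * X ^ (n * n))"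
  have "v = isum (\<lambda>k. (- 1) ^ k * X ^ (3 * (3 * (k * k)))) + isum (\<lambda>k. (- X) * ((- 1) ^ k * X ^ (3 * (5 * k + 6 * tri k))))
       + isum (\<lambda>k. X * ((- 1) ^ k * X ^ (3 * (Suc k + 6 * tri (Suc k)))))"
    unfolding v_def by (subst isum_split3[OF n]) (simp only: e power_add s power_Suc[of X], simp del: tri_Suc add: mult_ac)
  also have "isum (\<lambda>k. (- 1) ^ k * X ^ (3 * (3 * (k * k)))) = E (E v)"
    unfolding v_def by (subst E_isum_sign, simp)+ simp
  also have "isum (\<lambda>k. (- X) * ((- 1) ^ k * X ^ (3 * (5 * k + 6 * tri k)))) = (- X) * E (isum (\<lambda>k. (- 1) ^ k * X ^ (5 * k + 6 * tri k)))"
    by (subst isum_mult[OF null_seq_X_power], simp, subst E_isum_sign) auto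
  also have "isum (\<lambda>k. X * ((- 1) ^ k * X ^ (3 * (Suc k + 6 * tri (Suc k))))) = X * E (isum (\<lambda>k. (- 1) ^ k * X ^ (Suc k + 6 * tri (Suc k))))"
    by (subst isum_mult[OF null_seq_X_power], simp, subst E_isum_sign) auto
  finally have "v = E (E v) - X * E phi3"
    by (simp add: phi3_def fps_compose_sub_distrib algebra_simps)
  then have "phi = 2 * (E (E v) - X * E phi3) - 1" by (simp add: phi_def v_def)
  moreover have "E (E phi) = 2 * E (E v) - 1"
    by (simp add: phi_def v_def fps_compose_sub_distrib fps_compose_mult_distrib)
  ultimately show ?thesis by (simp only:) (simp add: algebra_simps)
qed

section \<open>The cubic continued fraction\<close>

definition sect :: "nat \<Rightarrow> rat fps \<Rightarrow> rat fps" where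
  "sect k F = Abs_fps (\<lambda>n. F $ (3 * n + k))"

lemma sect_add: "sect k (F + G) = sect k F + sect k G"
  and sect_diff: "sect k (F - G) = sect k F - sect k G"
  by (simp_all add: sect_def fps_eq_iff)

lemma E_add: "E (F + G) = E F + E G"
  and E_diff: "E (F - G) = E F - E G"
  and E_mult: "E (F * G) = E F * E G"
  and E_power: "E (F ^ n) = E F ^ n"
  and E_X: "E X = X ^ 3"
  and E_1: "E 1 = 1"
  and E_numeral: "E (numeral k) = numeral k"
  by (simp_all add: fps_compose_add_distrib fps_compose_sub_distrib fps_compose_mult_distrib flip: fps_compose_power)

lemmas E_simps = E_add E_diff E_mult E_power E_X E_1 E_numeral

lemma trisection: "F = E (sect 0 F) + X * E (sect 1 F) + X ^ 2 * E (sect 2 F)"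
proof (rule fps_ext)
  fix n
  have *: "(X * G) $ n = (if n = 0 then 0 else G $ (n - 1))" for G by simp
  have "n mod 3 = 0 \<or> n mod 3 = 1 \<or> n mod 3 = 2" by linarith
  then show "F $ n = (E (sect 0 F) + X * E (sect 1 F) + X ^ 2 * E (sect 2 F)) $ n"
  proof (elim disjE)
    assume "n mod 3 = 0"
    then obtain m where "n = 3 * m" by (metis mult_div_mod_eq add_0_right)
    moreover have "\<not> 3 dvd 3 * m - Suc 0" if "m > 0" using that by presburger
    moreover have "\<not> 3 dvd 3 * m - 2" if "m > 0" using that by presburger
    ultimately show ?thesis
      by (cases "m = 0") (auto simp: fps_compose_X_power_nth sect_def fps_X_power_mult_nth)
  next
    assume "n mod 3 = 1"
    then obtain m where "n = 3 * m + 1" by (metis mult_div_mod_eq)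
    moreover have "\<not> 3 dvd 3 * m + 1" by presburger
    moreover have "\<not> 3 dvd 3 * m + 1 - 2" if "m > 0" using that by presburger
    ultimately show ?thesis
      by (cases "m = 0") (auto simp: fps_compose_X_power_nth sect_def fps_X_power_mult_nth)
  next
    assume "n mod 3 = 2"
    then obtain m where "n = 3 * m + 2" by (metis mult_div_mod_eq)
    moreover have "\<not> 3 dvd 3 * m + 1" "\<not> 3 dvd 3 * m + 2" by presburger+
    ultimately show ?thesis
      by (auto simp: fps_compose_X_power_nth sect_def fps_X_power_mult_nth)
  qed
qed

lemma sect_trisection:
  "sect 0 (E A + X * E B + X ^ 2 * E C) = A"
  "sect 1 (E A + X * E B + X ^ 2 * E C) = B"
  "sect 2 (E A + X * E B + X ^ 2 * E C) = C"
proof -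
  have d: "\<not> 3 dvd Suc (3 * n)" "\<not> 3 dvd Suc (Suc (3 * n))" "3 dvd 3 * n - Suc 0 \<longleftrightarrow> n = 0"
    "3 dvd 3 * n - 2 \<longleftrightarrow> n = 0" "3 dvd Suc (3 * n) - 2 \<longleftrightarrow> n = 0" for n :: nat
    by presburger+
  have e: "Suc (3 * n) div 3 = n" "Suc (Suc (3 * n)) div 3 = n" for n :: nat by presburger+
  show "sect 0 (E A + X * E B + X ^ 2 * E C) = A"
    "sect 1 (E A + X * E B + X ^ 2 * E C) = B"
    "sect 2 (E A + X * E B + X ^ 2 * E C) = C"
    by (auto simp: fps_eq_iff sect_def fps_compose_X_power_nth fps_X_power_mult_nth d e)
qed

lemma sect_mult_E:
  assumes "k < 3" shows "sect k (F * E G) = sect k F * G"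
proof -
  have *: "F * E G = E (sect 0 F * G) + X * E (sect 1 F * G) + X ^ 2 * E (sect 2 F * G)"
    by (subst trisection[of F]) (simp add: E_mult algebra_simps)
  consider "k = 0" | "k = 1" | "k = 2" using assms by linarith
  then show ?thesis by cases (simp_all only: * sect_trisection)
qed

lemma sect_mult:
  "sect 0 (F * G) = sect 0 F * sect 0 G + X * (sect 1 F * sect 2 G + sect 2 F * sect 1 G)" (is ?A)
  "sect 1 (F * G) = sect 0 F * sect 1 G + sect 1 F * sect 0 G + X * (sect 2 F * sect 2 G)" (is ?B)
  "sect 2 (F * G) = sect 0 F * sect 2 G + sect 1 F * sect 1 G + sect 2 F * sect 0 G" (is ?C)
proof -
  have "F * G = (E (sect 0 F) + X * E (sect 1 F) + X ^ 2 * E (sect 2 F)) * (E (sect 0 G) + X * E (sect 1 G) + X ^ 2 * E (sect 2 G))"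
    using trisection[of F] trisection[of G] by simp
  also have "\<dots> = E (sect 0 F * sect 0 G + X * (sect 1 F * sect 2 G + sect 2 F * sect 1 G))
     + X * E (sect 0 F * sect 1 G + sect 1 F * sect 0 G + X * (sect 2 F * sect 2 G))
     + X ^ 2 * E (sect 0 F * sect 2 G + sect 1 F * sect 1 G + sect 2 F * sect 0 G)"
    unfolding E_simps by (simp add: algebra_simps power2_eq_square power3_eq_cube)
  finally show ?A ?B ?C by (simp_all only: sect_trisection)
qed

text \<open>The product of \<open>F(\<omega>\<^sup>j q)\<close> over the cube roots of unity, with \<open>q\<^sup>3\<close> replaced by \<open>q\<close>.\<close>

definition norm3 :: "rat fps \<Rightarrow> rat fps" where
  "norm3 F = sect 0 F ^ 3 + X * sect 1 F ^ 3 + X ^ 2 * sect 2 F ^ 3 - 3 * X * sect 0 F * sect 1 F * sect 2 F"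

text \<open>This is the norm form with respect to the basis \<open>1, X, X ^ 2\<close> over the
  series in \<open>X ^ 3\<close>; its multiplicativity is a polynomial identity.\<close>

lemma norm3_mult: "norm3 (F * G) = norm3 F * norm3 G"
proof -
  have *: "(a * a' + x * (b * c' + c * b')) ^ 3 + x * (a * b' + b * a' + x * (c * c')) ^ 3
      + x ^ 2 * (a * c' + b * b' + c * a') ^ 3
      - 3 * x * (a * a' + x * (b * c' + c * b')) * (a * b' + b * a' + x * (c * c')) * (a * c' + b * b' + c * a')
    = (a ^ 3 + x * b ^ 3 + x ^ 2 * c ^ 3 - 3 * x * a * b * c) * (a' ^ 3 + x * b' ^ 3 + x ^ 2 * c' ^ 3 - 3 * x * a' * b' * c')"
    for a b c a' b' c' x :: "rat fps"
    by algebra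
  show ?thesis unfolding norm3_def sect_mult by (rule *)
qed

lemma norm3_1: "norm3 1 = 1"
  using sect_trisection[of 1 0 0] by (simp add: norm3_def)

lemma norm3_power: "norm3 (F ^ n) = norm3 F ^ n"
  by (induction n) (simp_all add: norm3_mult norm3_1)

lemma norm3_E: "norm3 (E F) = F ^ 3"
  using sect_trisection[of F 0 0] by (simp add: norm3_def)

lemma norm3_1_X: "norm3 (1 + X * E F) = 1 + X * F ^ 3"
  using sect_trisection[of 1 F 0] by (simp add: norm3_def)

text \<open>For \<open>m\<close> prime to 3 the factors \<open>1 - \<omega>^(jm) q^m\<close>
  multiply to \<open>1 - q^(3m)\<close>.\<close>

lemma norm3_1_minus_X_power:
  assumes "\<not> 3 dvd m" shows "norm3 (1 - X ^ m) = 1 - X ^ m"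
proof -
  have "m mod 3 = 1 \<or> m mod 3 = 2" using assms by presburger
  then show ?thesis
  proof
    assume "m mod 3 = 1"
    then obtain k where m: "m = 3 * k + 1" by (metis mult_div_mod_eq)
    have "1 - X ^ m = 1 + X * E (- (X ^ k))"
      by (simp add: m fps_compose_uminus X_power_compose)
    then show ?thesis
      by (simp only: norm3_1_X) (simp add: fps_compose_uminus X_power_compose mult.commute flip: power_mult)
  next
    assume "m mod 3 = 2"
    then obtain k where m: "m = 3 * k + 2" by (metis mult_div_mod_eq)
    have "1 - X ^ m = E 1 + X * E 0 + X ^ 2 * E (- (X ^ k))"
      by (simp add: m fps_compose_uminus X_power_compose power_add power2_eq_square mult_ac)
    then show ?thesis unfolding norm3_def by (simp only: sect_trisection)
      (simp add: power2_eq_square mult_ac fps_compose_uminus X_power_compose flip: power_mult)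
  qed
qed

lemma feq_norm3:
  assumes "feq (3 * N) F G" shows "feq N (norm3 F) (norm3 G)"
proof -
  have *: "feq N (sect k F) (sect k G)" if "k < 3" for k
    using assms that by (auto simp: feq_def sect_def)
  show ?thesis unfolding norm3_def power3_eq_cube
    by (intro feq_add feq_diff feq_mult * feq_refl) auto
qed

text \<open>All exponents \<open>a + 3 * b * k\<close> are prime to 3, so the norm fixes every
  factor.\<close>

lemma norm3_qinf:
  assumes "\<not> 3 dvd a" "b > 0"
  shows "norm3 (qinf (X ^ a) (X ^ (3 * b))) = qinf (X ^ a) (X ^ (3 * b))"
proof (rule qinf_eqI[of _ _ _ "\<lambda>N. 2 * N"])
  fix N
  have *: "norm3 (qpoch (X ^ a) (X ^ (3 * b)) n) = qpoch (X ^ a) (X ^ (3 * b)) n" for n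
  proof (induction n)
    case (Suc n)
    have "\<not> 3 dvd a + 3 * (b * n)" using assms(1) by presburger
    from norm3_1_minus_X_power[OF this] Suc.IH show ?case
      by (simp add: qpoch_def norm3_mult power_add power_mult mult.assoc)
  qed (simp add: qpoch_def norm3_1)
  have "feq N (norm3 (qinf (X ^ a) (X ^ (3 * b)))) (norm3 (qpoch (X ^ a) (X ^ (3 * b)) (3 * N)))"
    by (intro feq_norm3 feq_qinf) (use assms in auto)
  then show "feq N (norm3 (qinf (X ^ a) (X ^ (3 * b)))) (qpoch (X ^ a) (X ^ (3 * b)) (N + 2 * N))"
    unfolding * by simp
qed (use assms in auto)

text \<open>The factors of \<open>J m\<close> with exponent prime to 3 are fixed by the norm; the
  others form \<open>J (3 * m) = E (J m)\<close>, whose norm is \<open>J m ^ 3\<close>.\<close>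

lemma norm3_J:
  assumes "\<not> 3 dvd m" shows "norm3 (J m) * J (3 * m) = J m ^ 4"
proof -
  have m: "m > 0" using assms by (cases m) auto
  have "J m = qinf (X ^ m) (X ^ (3 * m)) * qinf (X ^ (2 * m)) (X ^ (3 * m)) * J (3 * m)"
    using qinf_split[of "X ^ m" 3 "X ^ m"] m
    by (simp add: numeral_3_eq_3 mult.assoc flip: power_mult power_add) (simp add: mult_ac add_ac mult_2_right)
  note * = this
  have d: "\<not> 3 dvd 2 * m" using assms by presburger
  have "norm3 (J m) = norm3 (qinf (X ^ m) (X ^ (3 * m)) * qinf (X ^ (2 * m)) (X ^ (3 * m)) * E (J m))"
    unfolding E_J[OF m] by (rule arg_cong[OF *])
  also have "\<dots> = qinf (X ^ m) (X ^ (3 * m)) * qinf (X ^ (2 * m)) (X ^ (3 * m)) * J m ^ 3"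
    by (simp only: norm3_mult norm3_E norm3_qinf[OF assms m] norm3_qinf[OF d m])
  finally have "norm3 (J m) * J (3 * m) = (qinf (X ^ m) (X ^ (3 * m)) * qinf (X ^ (2 * m)) (X ^ (3 * m)) * J (3 * m)) * J m ^ 3"
    by (simp only: mult_ac)
  also have "\<dots> = J m ^ 4" by (subst *[symmetric]) (simp add: power3_eq_cube power4_eq_xxxx mult_ac)
  finally show ?thesis .
qed

text \<open>Ramanujan's cubic continued fraction without its leading factor q^(1/3).\<close>

definition S :: "rat fps" where
  "S = J 1 * J 6 ^ 3 * inverse (J 2 * J 3 ^ 3)"

lemma S_eta: "S * (J 2 * J 3 ^ 3) = J 1 * J 6 ^ 3"
proof -
  have "inverse (J 2 * J 3 ^ 3) * (J 2 * J 3 ^ 3) = 1"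
    by (intro inverse_mult_eq_1) (simp add: J_nth_0 fps_power_zeroth)
  then show ?thesis unfolding S_def by (simp add: mult.assoc)
qed

lemma E_J_1: "E (J 1) = J 3" and E_J_2: "E (J 2) = J 6"
  using E_J[of 1] E_J[of 2] by simp_all

lemma E_psi_eta: "E psi * J 3 = J 6 ^ 2"
  using arg_cong[OF psi_eta, of E] by (simp only: E_mult E_power E_J_1 E_J_2)

lemma E_phi_eta: "E phi * J 6 = J 3 ^ 2"
  using arg_cong[OF phi_eta, of E] by (simp only: E_mult E_power E_J_1 E_J_2)

text \<open>With \<open>phi3_S\<close>, this lets the single quotient \<open>S\<close> govern the
  dissections of both \<open>psi\<close> and \<open>phi\<close>.\<close>

lemma psi3_S: "psi3 * S = E psi"
proof -
  have "psi3 * S * (J 1 * J 2 * J 3 ^ 3 * J 6) = (psi3 * J 1 * J 6) * (S * (J 2 * J 3 ^ 3))"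
    by (simp only: mult_ac)
  also have "\<dots> = J 2 * J 3 ^ 2 * J 1 * J 6 * J 6 ^ 2"
    unfolding psi3_eta S_eta by (simp only: power3_eq_cube power2_eq_square mult_ac)
  also have "\<dots> = E psi * (J 1 * J 2 * J 3 ^ 3 * J 6)"
    unfolding E_psi_eta[symmetric] by (simp only: power3_eq_cube power2_eq_square mult_ac)
  finally show ?thesis using J_nonzero[of 1] J_nonzero[of 2] J_nonzero[of 3] J_nonzero[of 6] by simp
qed

lemma phi3_S: "phi3 = S * E phi"
proof -
  have "S * E phi * (J 2 * J 3 ^ 3 * J 6) = (S * (J 2 * J 3 ^ 3)) * (E phi * J 6)"
    by (simp only: mult_ac)
  also have "\<dots> = (J 1 * J 6 ^ 2) * J 3 ^ 2 * J 6"
    unfolding E_phi_eta S_eta by (simp only: power3_eq_cube power2_eq_square mult_ac)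
  also have "\<dots> = phi3 * (J 2 * J 3 ^ 3 * J 6)"
    unfolding phi3_eta[symmetric] by (simp only: power3_eq_cube power2_eq_square mult_ac)
  finally show ?thesis using J_nonzero[of 2] J_nonzero[of 3] J_nonzero[of 6] by simp
qed

lemma psi3_cube: "psi3 ^ 3 * phi = psi * E phi ^ 3"
proof -
  have "psi3 ^ 3 * phi * (J 1 ^ 3 * J 6 ^ 3 * J 2) = (psi3 * J 1 * J 6) ^ 3 * (phi * J 2)"
    by (simp only: power_mult_distrib mult_ac)
  also have "\<dots> = J 2 ^ 2 * (J 3 ^ 2) ^ 3 * J 1 ^ 2 * J 2"
    unfolding psi3_eta phi_eta by (simp only: power_mult_distrib power3_eq_cube power2_eq_square mult_ac)
  also have "\<dots> = psi * E phi ^ 3 * (J 1 ^ 3 * J 6 ^ 3 * J 2)"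
    unfolding E_phi_eta[symmetric] psi_eta[symmetric]
    by (simp only: power_mult_distrib power3_eq_cube power2_eq_square mult_ac)
  finally show ?thesis using J_nonzero[of 1] J_nonzero[of 2] J_nonzero[of 6] by simp
qed

text \<open>Reduces the dissection of \<open>even_part\<close> to those of \<open>psi\<close> and
  \<open>phi\<close>.\<close>

lemma even_part_phi: "even_part * phi = psi ^ 2"
proof -
  have "even_part * phi * (J 1 ^ 4 * J 2) = (even_part * J 1 ^ 4) * (phi * J 2)"
    by (simp only: mult_ac)
  also have "\<dots> = (J 2 ^ 2) ^ 2 * J 1 ^ 2 * J 2"
    unfolding even_part_eta phi_eta by (simp add: eval_nat_numeral mult_ac)
  also have "\<dots> = psi ^ 2 * (J 1 ^ 4 * J 2)"
    unfolding psi_eta[symmetric] by (simp only: power_mult_distrib power4_eq_xxxx power2_eq_square mult_ac)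
  finally show ?thesis using J_nonzero[of 1] J_nonzero[of 2] by simp
qed

text \<open>\<open>s(q)\<close> is Ramanujan's cubic continued fraction at \<open>q\<^sup>3\<close>, and \<open>w(q)\<close> is its cube at \<open>q\<close>.\<close>

definition s :: "rat fps" where "s = X * E S"
definition w :: "rat fps" where "w = X * S ^ 3"

lemma s_cube: "s ^ 3 = E w"
  by (simp add: s_def w_def E_simps power_mult_distrib)

lemma psi_s: "psi = E psi3 * (1 + s)"
  by (subst psi_dissection) (simp add: s_def E_mult algebra_simps flip: psi3_S)

lemma phi_s: "phi = E (E phi) * (1 - 2 * s)"
  by (subst phi_dissection) (simp add: s_def phi3_S E_mult algebra_simps)

text \<open>The norm of \<open>psi\<close> is computed twice, from the dissection
  \<open>psi_s\<close> and from the eta quotient by \<open>norm3_J\<close>. The same is done for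
  \<open>phi\<close> in \<open>norm3_phi\<close>.\<close>

lemma norm3_psi: "psi3 ^ 3 * (1 + w) * E psi = psi ^ 4"
proof -
  have n1: "norm3 (J 1) * J 3 = J 1 ^ 4" using norm3_J[of 1] by simp
  have n2: "norm3 (J 2) * J 6 = J 2 ^ 4" using norm3_J[of 2] by simp
  have p: "norm3 psi * norm3 (J 1) = norm3 (J 2) ^ 2"
    using arg_cong[OF psi_eta, of norm3] by (simp only: norm3_mult norm3_power)
  have "norm3 psi = psi3 ^ 3 * (1 + w)"
    by (subst psi_s) (simp add: norm3_mult norm3_E norm3_1_X s_def w_def)
  moreover have "norm3 psi * E psi = psi ^ 4"
  proof -
    have "norm3 psi * E psi * (J 1 ^ 4 * J 6 ^ 2) = (norm3 psi * norm3 (J 1)) * (E psi * J 3) * J 6 ^ 2"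
      unfolding n1[symmetric] by (simp only: mult_ac)
    also have "\<dots> = (norm3 (J 2) * J 6) ^ 2 * J 6 ^ 2"
      unfolding p E_psi_eta by (simp only: power2_eq_square mult_ac)
    also have "\<dots> = (J 2 ^ 2) ^ 4 * J 6 ^ 2" unfolding n2 by (simp flip: power_mult)
    also have "\<dots> = psi ^ 4 * (J 1 ^ 4 * J 6 ^ 2)"
      unfolding psi_eta[symmetric] by (simp only: power_mult_distrib mult_ac)
    finally show ?thesis using J_nonzero[of 1] J_nonzero[of 6] by simp
  qed
  ultimately show ?thesis by simp
qed

lemma norm3_phi: "E phi ^ 4 * (1 - 8 * w) = phi ^ 4"
proof -
  have n1: "norm3 (J 1) * J 3 = J 1 ^ 4" using norm3_J[of 1] by simp
  have n2: "norm3 (J 2) * J 6 = J 2 ^ 4" using norm3_J[of 2] by simp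
  have p: "norm3 phi * norm3 (J 2) = norm3 (J 1) ^ 2"
    using arg_cong[OF phi_eta, of norm3] by (simp only: norm3_mult norm3_power)
  have "1 - 2 * s = 1 + X * E (- 2 * S)"
    by (simp add: s_def E_mult fps_compose_uminus)
  then have "norm3 (1 - 2 * s) = 1 + X * (- 2 * S) ^ 3" by (simp only: norm3_1_X)
  also have "\<dots> = 1 - 8 * w" by (simp add: w_def power_mult_distrib)
  finally have "norm3 phi = E phi ^ 3 * (1 - 8 * w)"
    by (subst phi_s) (simp only: norm3_mult norm3_E)
  moreover have "norm3 phi * E phi = phi ^ 4"
  proof -
    have "norm3 phi * E phi * (J 2 ^ 4 * J 3 ^ 2) = (norm3 phi * norm3 (J 2)) * (E phi * J 6) * J 3 ^ 2"
      unfolding n2[symmetric] by (simp only: mult_ac)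
    also have "\<dots> = (norm3 (J 1) * J 3) ^ 2 * J 3 ^ 2"
      unfolding p E_phi_eta by (simp only: power2_eq_square mult_ac)
    also have "\<dots> = (J 1 ^ 2) ^ 4 * J 3 ^ 2" unfolding n1 by (simp flip: power_mult)
    also have "\<dots> = phi ^ 4 * (J 2 ^ 4 * J 3 ^ 2)"
      unfolding phi_eta[symmetric] by (simp only: power_mult_distrib mult_ac)
    finally show ?thesis using J_nonzero[of 2] J_nonzero[of 3] by simp
  qed
  ultimately show ?thesis by (simp add: power3_eq_cube power4_eq_xxxx mult_ac)
qed

lemma s_nth_0: "s $ 0 = 0" and w_nth_0: "w $ 0 = 0"
  by (simp_all add: s_def w_def)

lemma one_plus_nonzero: "F $ 0 = 0 \<Longrightarrow> 1 + F \<noteq> 0" for F :: "rat fps"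
  by (metis add_cancel_left_left fps_add_nth fps_one_nth fps_zero_nth one_neq_zero add.commute add_0)

lemma psi_nonzero: "psi \<noteq> 0"
  using psi_eta J_nonzero[of 2] by auto
lemma phi_nonzero: "phi \<noteq> 0"
  using phi_eta J_nonzero[of 1] by auto
lemma psi3_nonzero: "psi3 \<noteq> 0"
  using psi3_eta J_nonzero[of 2] J_nonzero[of 3] by auto

lemma E_nonzero: "F \<noteq> 0 \<Longrightarrow> E F \<noteq> 0"
  using compose_X_power_inj[of 3 F 0] by auto

text \<open>The classical relation between the continued fraction at q and at q^3. It results from
  eliminating the theta functions from the two norm identities, taken at q^3, and the
  dissections.\<close>

lemma cubic_continued_fraction: "w * (1 + 2 * s + 4 * s ^ 2) = s * (1 - s + s ^ 2)"
proof -
  have a: "w * psi * E phi ^ 3 = X * E psi ^ 3 * phi"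
  proof -
    have "w * psi * E phi ^ 3 = X * S ^ 3 * (psi3 ^ 3 * phi)"
      unfolding psi3_cube w_def by (simp only: mult_ac)
    also have "\<dots> = X * (psi3 * S) ^ 3 * phi" by (simp only: power_mult_distrib mult_ac)
    finally show ?thesis unfolding psi3_S .
  qed
  have b: "E psi3 ^ 3 * (1 + s ^ 3) * E (E psi) = E psi ^ 4"
    using arg_cong[OF norm3_psi, of E] by (simp only: E_simps s_cube)
  have c: "E (E phi) ^ 4 * (1 - 8 * s ^ 3) = E phi ^ 4"
    using arg_cong[OF norm3_phi, of E] by (simp only: E_simps s_cube)
  have d: "E psi3 ^ 3 * E phi = E psi * E (E phi) ^ 3"
    using arg_cong[OF psi3_cube, of E] by (simp only: E_simps)
  have e: "X * E (E psi) = s * E psi3"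
    unfolding s_def by (simp only: E_mult mult_ac flip: psi3_S)
  define P where "P = E psi3 * E (E phi) * (E psi * E (E phi) ^ 3)"
  have "w * (1 + s) * (1 - 8 * s ^ 3) * P = w * (E psi3 * (1 + s)) * (E (E phi) ^ 4 * (1 - 8 * s ^ 3)) * E psi"
    by (simp only: P_def power3_eq_cube power4_eq_xxxx mult_ac)
  also have "\<dots> = (w * psi * E phi ^ 3) * E phi * E psi"
    unfolding c psi_s[symmetric] by (simp only: power3_eq_cube power4_eq_xxxx mult_ac)
  also have "\<dots> = X * E psi ^ 4 * (E (E phi) * (1 - 2 * s)) * E phi"
    unfolding a phi_s[symmetric] by (simp only: power3_eq_cube power4_eq_xxxx mult_ac)
  also have "\<dots> = (X * E (E psi)) * E psi3 ^ 3 * (1 + s ^ 3) * (E (E phi) * (1 - 2 * s)) * E phi"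
    unfolding b[symmetric] by (simp only: mult_ac)
  also have "\<dots> = s * (1 + s ^ 3) * (1 - 2 * s) * (E psi3 * E (E phi) * (E psi3 ^ 3 * E phi))"
    unfolding e by (simp only: mult_ac)
  finally have "w * (1 + s) * (1 - 8 * s ^ 3) * P = s * (1 + s ^ 3) * (1 - 2 * s) * P"
    unfolding d by (simp only: P_def mult_ac)
  moreover have "P \<noteq> 0"
    unfolding P_def using psi_nonzero phi_nonzero psi3_nonzero by (simp add: E_nonzero)
  ultimately have "w * (1 + s) * (1 - 8 * s ^ 3) = s * (1 + s ^ 3) * (1 - 2 * s)" by simp
  \<comment> \<open>Both \<open>1 + s ^ 3\<close> and \<open>1 - 8 * s ^ 3\<close> factor; the
    common part \<open>(1 + s) * (1 - 2 * s)\<close> is split off to be cancelled.\<close>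
  then have "((1 + s) * (1 - 2 * s)) * (w * (1 + 2 * s + 4 * s ^ 2)) = ((1 + s) * (1 - 2 * s)) * (s * (1 - s + s ^ 2))"
    by algebra
  moreover have "1 + s \<noteq> 0" "1 - 2 * s \<noteq> 0"
    using one_plus_nonzero[of s] one_plus_nonzero[of "- 2 * s"] s_nth_0 by simp_all
  ultimately show ?thesis by simp
qed

lemma even_part_s: "even_part * (1 - 2 * s) * E S ^ 2 = E (E even_part) * (1 + s) ^ 2"
proof -
  have 1: "E (E even_part) * E (E phi) = E (E psi) ^ 2"
    using arg_cong[OF even_part_phi, of "\<lambda>F. E (E F)"] by (simp only: E_simps)
  have 2: "E psi3 * E S = E (E psi)"
    using arg_cong[OF psi3_S, of E] by (simp only: E_simps)
  have "even_part * (1 - 2 * s) * E S ^ 2 * E (E phi) = even_part * (E (E phi) * (1 - 2 * s)) * E S ^ 2"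
    by (simp only: mult_ac)
  also have "\<dots> = psi ^ 2 * E S ^ 2"
    unfolding phi_s[symmetric] even_part_phi ..
  also have "\<dots> = (E psi3 * E S) ^ 2 * (1 + s) ^ 2"
    by (subst psi_s) (simp only: power_mult_distrib mult_ac)
  also have "\<dots> = E (E even_part) * (1 + s) ^ 2 * E (E phi)"
    unfolding 2 1[symmetric] by (simp only: mult_ac)
  finally show ?thesis using phi_nonzero by (simp add: E_nonzero)
qed

section \<open>The operators on polynomials in x\<close>

definition T :: "rat fps" where "T = inverse (1 - 8 * w)"
definition x :: "rat fps" where "x = w * T"
text \<open>This is \<open>1 / (1 - 2 * s)\<close>, written with its denominator in the image of
  \<open>E\<close> so that its dissection can be read off.\<close>

definition u :: "rat fps" where "u = (1 + 2 * s + 4 * s ^ 2) * E T"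
definition r :: "rat fps" where "r = s * u"

lemma T_w: "T * (1 - 8 * w) = 1"
  unfolding T_def by (intro inverse_one_minus) (simp add: w_nth_0)

lemma T_x: "T = 1 + 8 * x"
proof -
  have "T = T * (1 - 8 * w) + 8 * x" unfolding x_def by algebra
  then show ?thesis unfolding T_w .
qed

lemma E_T_s: "E T * (1 - 8 * s ^ 3) = 1"
  using arg_cong[OF T_w, of E] by (simp only: E_simps s_cube)

lemma u_s: "u * (1 - 2 * s) = 1"
proof -
  have "u * (1 - 2 * s) = E T * (1 - 8 * s ^ 3)"
    unfolding u_def by algebra
  then show ?thesis unfolding E_T_s .
qed

lemma u_r: "u = 1 + 2 * r"
proof -
  have "u = u * (1 - 2 * s) + 2 * r" unfolding r_def by algebra
  then show ?thesis unfolding u_s .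
qed

text \<open>Cube \<open>r = s * (1 + 2 * r)\<close> and move the term
  \<open>8 * s ^ 3 * r ^ 3\<close> to the left; \<open>E x\<close> is
  \<open>s ^ 3 / (1 - 8 * s ^ 3)\<close>.\<close>

lemma r_cubic: "r ^ 3 = E x * (1 + 6 * r + 12 * r ^ 2)"
proof -
  have y: "E x = s ^ 3 * E T" by (simp add: x_def E_mult s_cube)
  have "r ^ 3 = s ^ 3 * (1 + 2 * r) ^ 3"
    unfolding u_r[symmetric] by (simp only: r_def power_mult_distrib)
  then have "r ^ 3 * (1 - 8 * s ^ 3) = s ^ 3 * (1 + 2 * r) ^ 3 - 8 * s ^ 3 * r ^ 3"
    by (simp only: right_diff_distrib mult_1_right mult_1_left mult_ac)
  also have "\<dots> = s ^ 3 * (1 + 6 * r + 12 * r ^ 2)" by algebra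
  finally have "r ^ 3 * (1 - 8 * s ^ 3) = s ^ 3 * (1 + 6 * r + 12 * r ^ 2)" .
  from eq_mult_inverse[OF E_T_s this] show ?thesis unfolding y by (simp only: mult_ac)
qed

lemma x_r: "x = r + 3 * r ^ 2 + 3 * r ^ 3"
proof -
  \<comment> \<open>The continued fraction relation gives
    \<open>(1 - 8 * w) * (1 + 2 * s + 4 * s ^ 2) = (1 - 2 * s) ^ 3\<close>, and
    \<open>w = x * (1 - 8 * w)\<close>.\<close>
  have "w * (1 + 2 * s + 4 * s ^ 2) = x * (1 - 2 * s) ^ 3"
    using cubic_continued_fraction T_w unfolding x_def by algebra
  then have "x * (1 - 2 * s) ^ 3 = s * (1 - s + s ^ 2)"
    unfolding cubic_continued_fraction by simp
  then have "x = s * (1 - s + s ^ 2) * u ^ 3"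
    using u_s by algebra
  also have "\<dots> = r * u ^ 2 - r ^ 2 * u + r ^ 3"
    unfolding r_def by algebra
  also have "\<dots> = r + 3 * r ^ 2 + 3 * r ^ 3" unfolding u_r by algebra
  finally show ?thesis .
qed

text \<open>Elimination of \<open>r\<close> between \<open>x_r\<close> and \<open>r_cubic\<close>;
  the proof exhibits the cofactor of the cubic relation.\<close>

lemma modular_equation:
  "x ^ 3 = (57 * E x + 1080 * E x ^ 2 + 5184 * E x ^ 3) * x ^ 2
         + (15 * E x + 279 * E x ^ 2 + 1296 * E x ^ 3) * x + (E x + 18 * E x ^ 2 + 81 * E x ^ 3)"
proof -
  define y where "y = E x"
  have "x ^ 3 - ((57 * y + 1080 * y ^ 2 + 5184 * y ^ 3) * x ^ 2
         + (15 * y + 279 * y ^ 2 + 1296 * y ^ 3) * x + (y + 18 * y ^ 2 + 81 * y ^ 3))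
      = (r ^ 3 - y * (1 + 6 * r + 12 * r ^ 2))
        * (1 + 18 * y + 81 * y ^ 2 + 9 * r + 171 * y * r + 810 * y ^ 2 * r + 36 * r ^ 2 + 675 * y * r ^ 2 + 3240 * y ^ 2 * r ^ 2 + 81 * r ^ 3 + 1296 * y * r ^ 3 + 5832 * y ^ 2 * r ^ 3 + 108 * r ^ 4 + 1134 * y * r ^ 4 + 3888 * y ^ 2 * r ^ 4 + 81 * r ^ 5 + 324 * y * r ^ 5 + 27 * r ^ 6)"
    unfolding x_r by algebra
  then show ?thesis unfolding y_def[symmetric] r_cubic[folded y_def] by simp
qed

lemma sect_s:
  assumes "F = E A + s * E B + s ^ 2 * E C"
  shows "sect 0 F = A" "sect 2 F = S ^ 2 * C"
proof -
  have "F = E A + X * E (S * B) + X ^ 2 * E (S ^ 2 * C)"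
    unfolding assms by (simp add: s_def E_simps power_mult_distrib)
  then show "sect 0 F = A" "sect 2 F = S ^ 2 * C"
    by (simp_all only: sect_trisection)
qed

lemma sect_0_r:
  assumes "F = E A + r * E B + r ^ 2 * E C"
  shows "sect 0 F = A + 4 * x * B + (4 * x + 48 * x ^ 2) * C"
proof -
  have "r = E (4 * x) + s * E T + s ^ 2 * E (2 * T)"
    unfolding r_def u_def x_def E_simps s_cube[symmetric] by algebra
  then have 1: "sect 0 r = 4 * x" by (rule sect_s)
  have "r ^ 2 = E (4 * w * T ^ 2 + 16 * w ^ 2 * T ^ 2) + s * E (12 * w * T ^ 2) + s ^ 2 * E (T ^ 2 + 16 * w * T ^ 2)"
    unfolding r_def u_def E_simps s_cube[symmetric] by algebra
  then have "sect 0 (r ^ 2) = 4 * w * T ^ 2 + 16 * w ^ 2 * T ^ 2" by (rule sect_s)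
  also have "\<dots> = 4 * x * T + 16 * x ^ 2"
    unfolding x_def by algebra
  also have "\<dots> = 4 * x + 48 * x ^ 2" unfolding T_x by algebra
  finally have 2: "sect 0 (r ^ 2) = 4 * x + 48 * x ^ 2" .
  have 0: "sect 0 (E A) = A" by (rule sect_s[of _ _ 0 0]) simp
  show ?thesis unfolding assms by (simp add: sect_add sect_mult_E 0 1 2)
qed

lemma S_nonzero: "S \<noteq> 0"
  using S_eta J_nonzero[of 1] J_nonzero[of 6] by auto

text \<open>By \<open>even_part_s\<close> the cofactor of \<open>h\<close> is
  \<open>(1 + s) ^ 2 * u = (1 + 3 * r) ^ 2 * (1 - 2 * s)\<close>. Multiplication by
  \<open>1 - 2 * s\<close> turns \<open>r\<close> into \<open>s\<close> and \<open>r ^ 2\<close>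
  into \<open>s * r\<close>, so only \<open>C\<close> reaches the exponents 2 modulo 3.\<close>

lemma sect_2_even_part:
  assumes "h * (1 + 3 * r) ^ 2 = E A + r * E B + r ^ 2 * E C"
  shows "sect 2 (even_part * h) = E even_part * (C * (1 + 8 * x))"
proof -
  have rs: "r * (1 - 2 * s) = s" using u_s by (simp add: r_def mult.assoc)
  have "(1 + 3 * r) * (1 - 2 * s) = (1 - 2 * s) + 3 * (r * (1 - 2 * s))" by algebra
  then have s1: "1 + s = (1 + 3 * r) * (1 - 2 * s)" unfolding rs by simp
  have "(1 + s) ^ 2 * u = (1 + 3 * r) ^ 2 * (1 - 2 * s) * (u * (1 - 2 * s))"
    unfolding s1 by (simp only: power2_eq_square mult_ac)
  then have "(1 + s) ^ 2 * u * h = (h * (1 + 3 * r) ^ 2) * (1 - 2 * s)"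
    unfolding u_s by (simp add: mult_ac)
  also have "\<dots> = E A * (1 - 2 * s) + (r * (1 - 2 * s)) * E B + r * (r * (1 - 2 * s)) * E C"
    unfolding assms by algebra
  also have "\<dots> = E A * (1 - 2 * s) + s * E B + s * r * E C"
    unfolding rs by (simp only: mult_ac)
  also have "s * r = s ^ 2 * ((1 + 2 * s + 4 * s ^ 2) * E T)"
    by (simp only: r_def u_def power2_eq_square mult.assoc)
  also have "E A * (1 - 2 * s) + s * E B + s ^ 2 * ((1 + 2 * s + 4 * s ^ 2) * E T) * E C
      = E (A + 2 * w * T * C) + s * E (B - 2 * A + 4 * w * T * C) + s ^ 2 * E (T * C)"
    unfolding E_simps s_cube[symmetric] by algebra
  finally have 1: "sect 2 ((1 + s) ^ 2 * u * h) = S ^ 2 * (T * C)" by (rule sect_s)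
  have "even_part * E S ^ 2 * (1 - 2 * s) = E (E even_part) * (1 + s) ^ 2"
    using even_part_s by (simp only: mult_ac)
  note 2 = eq_mult_inverse[OF u_s this]
  have "sect 2 (even_part * h) * S ^ 2 = sect 2 (even_part * h * E (S ^ 2))"
    by (simp add: sect_mult_E)
  also have "even_part * h * E (S ^ 2) = ((1 + s) ^ 2 * u * h) * E (E even_part)"
    unfolding E_power using arg_cong[OF 2, of "\<lambda>F. F * h"] by (simp only: mult_ac)
  also have "sect 2 \<dots> = E even_part * (C * (1 + 8 * x)) * S ^ 2"
    by (subst sect_mult_E, simp, subst 1) (simp add: T_x mult_ac)
  finally show ?thesis using S_nonzero by simp
qed

lemma sect_const: "k < 3 \<Longrightarrow> sect k (3 ^ n * F) = 3 ^ n * sect k F"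
  using sect_mult_E[of k F "3 ^ n"] by (simp add: E_power E_numeral mult.commute)

lemma sect_0_1: "sect 0 1 = 1"
  using sect_0_r[of 1 1 0 0] by simp

lemma sect_0_x: "sect 0 x = 19 * x + 360 * x ^ 2 + 1728 * x ^ 3"
proof -
  \<comment> \<open>The coefficients come from replacing \<open>r ^ 3\<close> in \<open>x_r\<close>
    by means of \<open>r_cubic\<close>; the later expansions of this kind arise likewise.\<close>
  have "x = E (3 * x) + r * E (1 + 18 * x) + r ^ 2 * E (3 + 36 * x)"
    unfolding E_simps using r_cubic x_r by algebra
  then have "sect 0 x = 3 * x + 4 * x * (1 + 18 * x) + (4 * x + 48 * x ^ 2) * (3 + 36 * x)"
    by (rule sect_0_r)
  then show ?thesis by algebra
qed

lemma sect_0_x2: "sect 0 (x ^ 2) = 10 * x + 1269 * x ^ 2 + 41904 * x ^ 3 + 585792 * x ^ 4 + 3732480 * x ^ 5 + 8957952 * x ^ 6"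
proof -
  have "x ^ 2 = E (6 * x + 297 * x ^ 2 + 3888 * x ^ 3 + 15552 * x ^ 4)
      + r * E (51 * x + 2052 * x ^ 2 + 24624 * x ^ 3 + 93312 * x ^ 4)
      + r ^ 2 * E (1 + 180 * x + 5292 * x ^ 2 + 54432 * x ^ 3 + 186624 * x ^ 4)"
    unfolding E_simps using r_cubic x_r by algebra
  then have "sect 0 (x ^ 2) = (6 * x + 297 * x ^ 2 + 3888 * x ^ 3 + 15552 * x ^ 4)
      + 4 * x * (51 * x + 2052 * x ^ 2 + 24624 * x ^ 3 + 93312 * x ^ 4)
      + (4 * x + 48 * x ^ 2) * (1 + 180 * x + 5292 * x ^ 2 + 54432 * x ^ 3 + 186624 * x ^ 4)"
    by (rule sect_0_r)
  also have "\<dots> = 10 * x + 1269 * x ^ 2 + 41904 * x ^ 3 + 585792 * x ^ 4 + 3732480 * x ^ 5 + 8957952 * x ^ 6"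
    by algebra
  finally show ?thesis .
qed

text \<open>Dividing by \<open>E even_part\<close> makes the operator send polynomials in
  \<open>x\<close> to polynomials in \<open>x\<close>.\<close>

definition V :: "rat fps \<Rightarrow> rat fps" where
  "V h = sect 2 (even_part * h) * inverse (E even_part)"

lemma even_part_nth_0: "even_part $ 0 = 1"
  by (simp add: even_part_def frakb_def beta_term_def qpoch_def fps_power_zeroth)

lemma inverse_E_even_part: "E even_part * inverse (E even_part) = 1"
  by (intro inverse_mult_eq_1') (simp add: even_part_nth_0)

lemma sect_2_V: "sect 2 (even_part * h) = E even_part * V h"
  using inverse_E_even_part by (simp add: V_def mult.left_commute)

lemma V_eq:
  assumes "h * (1 + 3 * r) ^ 2 = E A + r * E B + r ^ 2 * E C"
  shows "V h = C * (1 + 8 * x)"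
proof -
  have "V h = (E even_part * inverse (E even_part)) * (C * (1 + 8 * x))"
    unfolding V_def sect_2_even_part[OF assms] by (simp only: mult_ac)
  then show ?thesis unfolding inverse_E_even_part by simp
qed

lemma V_add: "V (F + G) = V F + V G"
  and V_diff: "V (F - G) = V F - V G"
  by (simp_all add: V_def sect_add sect_diff algebra_simps)

lemma V_mult_E: "V (F * E G) = V F * G"
  using sect_mult_E[of 2 "even_part * F" G] by (simp add: V_def mult_ac)

lemma V_1: "V 1 = 9 + 72 * x"
proof -
  have "1 * (1 + 3 * r) ^ 2 = E 1 + r * E 6 + r ^ 2 * E 9"
    unfolding E_simps by algebra
  from V_eq[OF this] show ?thesis by algebra
qed

lemma V_x: "V x = 9 + 729 * x + 15624 * x ^ 2 + 129600 * x ^ 3 + 373248 * x ^ 4"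
proof -
  have "x * (1 + 3 * r) ^ 2 = E (30 * x + 702 * x ^ 2 + 3888 * x ^ 3)
      + r * E (1 + 225 * x + 4536 * x ^ 2 + 23328 * x ^ 3)
      + r ^ 2 * E (9 + 657 * x + 10368 * x ^ 2 + 46656 * x ^ 3)"
    unfolding E_simps using r_cubic x_r by algebra
  from V_eq[OF this] show ?thesis by algebra
qed

lemma V_x2: "V (x ^ 2) = 1 + 674 * x + 55089 * x ^ 2 + 1756944 * x ^ 3 + 28133568 * x ^ 4
    + 242237952 * x ^ 5 + 1074954240 * x ^ 6 + 1934917632 * x ^ 7"
proof -
  have "x ^ 2 * (1 + 3 * r) ^ 2 =
        E (12 * x + 1944 * x ^ 2 + 73548 * x ^ 3 + 1135296 * x ^ 4 + 7838208 * x ^ 5 + 20155392 * x ^ 6)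
      + r * E (132 * x + 15336 * x ^ 2 + 513540 * x ^ 3 + 7394976 * x ^ 4 + 48708864 * x ^ 5 + 120932352 * x ^ 6)
      + r ^ 2 * E (1 + 666 * x + 49761 * x ^ 2 + 1358856 * x ^ 3 + 17262720 * x ^ 4 + 104136192 * x ^ 5 + 241864704 * x ^ 6)"
    unfolding E_simps using r_cubic x_r by algebra
  from V_eq[OF this] show ?thesis by algebra
qed

section \<open>Lattices of polynomials\<close>

text \<open>The integer polynomials in \<open>x\<close> whose \<open>n\<close>-th coefficient is divisible by \<open>3 ^ e n\<close>.\<close>

inductive_set lat :: "(nat \<Rightarrow> nat) \<Rightarrow> rat fps set" for e where
  base: "3 ^ e n * x ^ n \<in> lat e"
| add: "p \<in> lat e \<Longrightarrow> q \<in> lat e \<Longrightarrow> p + q \<in> lat e"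
| diff: "p \<in> lat e \<Longrightarrow> q \<in> lat e \<Longrightarrow> p - q \<in> lat e"

lemma lat_0: "0 \<in> lat e"
  using lat.diff[OF lat.base lat.base, of e 0 0] by simp

lemma lat_of_nat_mult: "p \<in> lat e \<Longrightarrow> of_nat k * p \<in> lat e"
  by (induction k) (auto simp: distrib_right lat_0 intro: lat.add)

lemma lat_monom:
  assumes "3 ^ e n dvd k" shows "of_nat k * x ^ n \<in> lat e"
proof -
  obtain j where "k = 3 ^ e n * j" using assms by (elim dvdE)
  then have "of_nat k * x ^ n = of_nat j * (3 ^ e n * x ^ n)" by (simp add: mult_ac)
  then show ?thesis using lat_of_nat_mult[OF lat.base] by (simp only:)
qed

lemma lat_numeral: "3 ^ e n dvd (numeral k :: nat) \<Longrightarrow> numeral k * x ^ n \<in> lat e"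
  using lat_monom[of e n "numeral k"] by simp

lemma lat_monom_mult:
  assumes "p \<in> lat e" "\<And>n. 3 ^ e (m + n) dvd k * 3 ^ e n"
  shows "of_nat k * x ^ m * p \<in> lat e"
  using assms(1)
proof induction
  case (base n)
  have "of_nat k * x ^ m * (3 ^ e n * x ^ n) = of_nat (k * 3 ^ e n) * x ^ (m + n)"
    by (simp add: power_add mult_ac)
  then show ?case using lat_monom[of e "m + n", OF assms(2)] by (simp only:)
qed (auto simp: distrib_left right_diff_distrib intro: lat.intros)

lemma lat_monom_mult':
  assumes "p \<in> lat e" "3 ^ i dvd (numeral k :: nat)" "\<And>n. e (m + n) \<le> i + e n"
  shows "numeral k * x ^ m * p \<in> lat e"
proof -
  have "3 ^ e (m + n) dvd (numeral k * 3 ^ e n :: nat)" for n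
    by (rule dvd_trans[OF le_imp_power_dvd[OF assms(3)]]) (simp add: power_add assms(2))
  from lat_monom_mult[OF assms(1) this] show ?thesis by simp
qed

lemma lat_3_mult: "p \<in> lat e \<Longrightarrow> 3 * p \<in> lat e"
  using lat_of_nat_mult[of p e 3] by simp

text \<open>Extraction of the exponents 0 modulo 3 maps \<open>lat eG\<close> to \<open>lat eH\<close>, and \<open>V\<close> maps \<open>lat eH\<close> to
  \<open>lat eV = 9 lat eG\<close>. Both are checked on powers of \<open>x\<close> up to the second and then propagated by the
  recurrence coming from the modular equation, whose coefficients are \<open>c2\<close>, \<open>c1\<close>, \<open>c0\<close>.\<close>

definition eG :: "nat \<Rightarrow> nat" where "eG n = n - 2"
definition eV :: "nat \<Rightarrow> nat" where "eV n = 2 + (n - 2)"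
text \<open>The exception at 1 reflects that \<open>sect 0 x\<close> and
  \<open>sect 0 (x ^ 2)\<close> have the linear coefficients 19 and 10, both prime to 3.\<close>

definition eH :: "nat \<Rightarrow> nat" where "eH n = (if n = 1 then 0 else n)"

definition c2 :: "rat fps" where "c2 = 57 * x + 1080 * x ^ 2 + 5184 * x ^ 3"
definition c1 :: "rat fps" where "c1 = 15 * x + 279 * x ^ 2 + 1296 * x ^ 3"
definition c0 :: "rat fps" where "c0 = x + 18 * x ^ 2 + 81 * x ^ 3"

lemma lat_cubic_mult:
  assumes "p \<in> lat e" "3 ^ i dvd (numeral a :: nat)" "3 ^ j dvd (numeral b :: nat)" "3 ^ k dvd (numeral c :: nat)"
    "\<And>n. e (1 + n) \<le> i + e n" "\<And>n. e (2 + n) \<le> j + e n" "\<And>n. e (3 + n) \<le> k + e n"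
  shows "(numeral a * x + numeral b * x ^ 2 + numeral c * x ^ 3) * p \<in> lat e"
  using lat_monom_mult'[OF assms(1,2,5)] lat_monom_mult'[OF assms(1,3,6)] lat_monom_mult'[OF assms(1,4,7)]
  by (simp add: distrib_right lat.add)

text \<open>The worst case is exponent 1, where the weight is 0 and multiplication by
  \<open>x ^ m\<close> raises it to \<open>m + 1\<close>. The multiples of \<open>c2\<close>,
  \<open>c1\<close>, \<open>c0\<close> are chosen so that the coefficients of \<open>x\<close>,
  \<open>x ^ 2\<close>, \<open>x ^ 3\<close> are divisible by 9, 27, 81.\<close>

lemma lat_eH_mult:
  assumes "p \<in> lat eH"
  shows "3 * c2 * p \<in> lat eH" "3 * c1 * p \<in> lat eH" "9 * c0 * p \<in> lat eH"
proof -
  have *: "eH (1 + n) \<le> 2 + eH n" "eH (2 + n) \<le> 3 + eH n" "eH (3 + n) \<le> 4 + eH n" for n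
    by (auto simp: eH_def)
  have "(171 * x + 3240 * x ^ 2 + 15552 * x ^ 3) * p \<in> lat eH"
       "(45 * x + 837 * x ^ 2 + 3888 * x ^ 3) * p \<in> lat eH"
       "(9 * x + 162 * x ^ 2 + 729 * x ^ 3) * p \<in> lat eH"
    by (rule lat_cubic_mult[OF assms _ _ _ *]; simp)+
  then show "3 * c2 * p \<in> lat eH" "3 * c1 * p \<in> lat eH" "9 * c0 * p \<in> lat eH"
    by (simp_all add: c2_def c1_def c0_def algebra_simps)
qed

lemma lat_eV_mult:
  assumes "p \<in> lat eV"
  shows "3 * c2 * p \<in> lat eV" "3 * c1 * p \<in> lat eV" "3 * c0 * p \<in> lat eV"
proof -
  have *: "eV (1 + n) \<le> 1 + eV n" "eV (2 + n) \<le> 2 + eV n" "eV (3 + n) \<le> 3 + eV n" for n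
    by (auto simp: eV_def)
  have "(171 * x + 3240 * x ^ 2 + 15552 * x ^ 3) * p \<in> lat eV"
       "(45 * x + 837 * x ^ 2 + 3888 * x ^ 3) * p \<in> lat eV"
       "(3 * x + 54 * x ^ 2 + 243 * x ^ 3) * p \<in> lat eV"
    by (rule lat_cubic_mult[OF assms _ _ _ *]; simp)+
  then show "3 * c2 * p \<in> lat eV" "3 * c1 * p \<in> lat eV" "3 * c0 * p \<in> lat eV"
    by (simp_all add: c2_def c1_def c0_def algebra_simps)
qed

lemma x_power_rec: "x ^ (n + 3) = x ^ (n + 2) * E c2 + x ^ (n + 1) * E c1 + x ^ n * E c0"
proof -
  have "x ^ (n + 3) = x ^ n * x ^ 3" by (simp add: power_add)
  also have "\<dots> = x ^ n * (E c2 * x ^ 2 + E c1 * x + E c0)"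
    by (subst modular_equation) (simp only: c2_def c1_def c0_def E_simps)
  finally show ?thesis by (simp add: power_add power2_eq_square algebra_simps)
qed

lemma sect_0_x_power_rec:
  "sect 0 (x ^ (n + 3)) = c2 * sect 0 (x ^ (n + 2)) + c1 * sect 0 (x ^ (n + 1)) + c0 * sect 0 (x ^ n)"
  unfolding x_power_rec sect_add by (simp only: sect_mult_E zero_less_numeral) (simp only: mult.commute)

lemma V_x_power_rec:
  "V (x ^ (n + 3)) = c2 * V (x ^ (n + 2)) + c1 * V (x ^ (n + 1)) + c0 * V (x ^ n)"
  unfolding x_power_rec V_add by (simp only: V_mult_E) (simp only: mult.commute)

lemma nat_add_numerals: "(1::nat) + 3 = 4" "(1::nat) + 2 = 3" "(1::nat) + 1 = 2"
  by simp_all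

text \<open>From index 5 on the recurrence refers only to indices at least 2, where
  \<open>eG\<close> and \<open>eH\<close> grow by one at each step.\<close>

lemma nat_cases5:
  fixes n :: nat
  obtains "n = 0" | "n = 1" | "n = 2" | "n = 3" | "n = 4" | m where "n = m + 5"
proof -
  have "n = 0 \<or> n = 1 \<or> n = 2 \<or> n = 3 \<or> n = 4 \<or> n = (n - 5) + 5" by linarith
  then show thesis using that by blast
qed

lemma sect_0_x_power: "3 ^ eG n * sect 0 (x ^ n) \<in> lat eH"
proof (induction n rule: less_induct)
  case (less n)
  have b0: "sect 0 (x ^ 0) \<in> lat eH" using lat.base[of eH 0] by (simp add: sect_0_1 eH_def)
  have b1: "sect 0 (x ^ 1) \<in> lat eH"
  proof -
    have "19 * x ^ 1 + 360 * x ^ 2 + 1728 * x ^ 3 \<in> lat eH"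
      by (intro lat.add lat_numeral) (simp_all add: eH_def)
    then show ?thesis by (simp add: sect_0_x)
  qed
  have b2: "sect 0 (x ^ 2) \<in> lat eH"
  proof -
    have "10 * x ^ 1 + 1269 * x ^ 2 + 41904 * x ^ 3 + 585792 * x ^ 4 + 3732480 * x ^ 5 + 8957952 * x ^ 6 \<in> lat eH"
      by (intro lat.add lat_numeral) (simp_all add: eH_def)
    then show ?thesis by (simp add: sect_0_x2)
  qed
  have b3: "3 * sect 0 (x ^ 3) \<in> lat eH"
  proof -
    \<comment> \<open>Only one factor 3 is available for \<open>c0\<close>, too little for
      \<open>lat_eH_mult\<close>; but it multiplies \<open>sect 0 1 = 1\<close>, and
      \<open>3 * c0\<close> itself lies in the lattice.\<close>
    have "3 * sect 0 (x ^ 3) = 3 * c2 * sect 0 (x ^ 2) + 3 * c1 * sect 0 (x ^ 1) + (3 * x ^ 1 + 54 * x ^ 2 + 243 * x ^ 3)"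
      using sect_0_x_power_rec[of 0] by (simp add: sect_0_1 c0_def algebra_simps flip: power2_eq_square)
    moreover have "3 * x ^ 1 + 54 * x ^ 2 + 243 * x ^ 3 \<in> lat eH"
      by (intro lat.add lat_numeral) (simp_all add: eH_def)
    ultimately show ?thesis using lat_eH_mult b1 b2 by (simp add: lat.add)
  qed
  show ?case
  proof (cases n rule: nat_cases5)
    case 5
    have "9 * sect 0 (x ^ 4) = 3 * c2 * (3 * sect 0 (x ^ 3)) + 3 * (3 * c1 * sect 0 (x ^ 2)) + 9 * c0 * sect 0 (x ^ 1)"
      using sect_0_x_power_rec[of 1] by (simp only: nat_add_numerals) (simp add: algebra_simps)
    also have "\<dots> \<in> lat eH" by (intro lat.add lat_3_mult lat_eH_mult b1 b2 b3)
    finally show ?thesis by (simp add: 5 eG_def)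
  next
    case (6 m)
    have "3 ^ eG n * sect 0 (x ^ n) = 3 * c2 * (3 ^ eG (m + 4) * sect 0 (x ^ (m + 4)))
       + 3 * (3 * c1 * (3 ^ eG (m + 3) * sect 0 (x ^ (m + 3)))) + 3 * (9 * c0 * (3 ^ eG (m + 2) * sect 0 (x ^ (m + 2))))"
      using sect_0_x_power_rec[of "m + 2"] by (simp add: 6 eG_def eval_nat_numeral algebra_simps)
    also have "\<dots> \<in> lat eH" by (intro lat.add lat_3_mult lat_eH_mult less) (simp_all add: 6)
    finally show ?thesis .
  qed (use b0 b1 b2 b3 in \<open>simp_all add: eG_def\<close>)
qed

text \<open>\<open>V 1\<close> and \<open>V x\<close> already lie in the lattice, but
  \<open>V (x ^ 2)\<close> has constant term 1 while \<open>eV 0 = 2\<close>, hence the factor 9.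
  From there on the recurrence propagates membership.\<close>

lemma V_x_power: "3 ^ eH n * V (x ^ n) \<in> lat eV"
proof (induction n rule: less_induct)
  case (less n)
  have b0: "V (x ^ 0) \<in> lat eV"
  proof -
    have "9 * x ^ 0 + 72 * x ^ 1 \<in> lat eV"
      by (intro lat.add lat_numeral) (simp_all add: eV_def)
    then show ?thesis by (simp add: V_1)
  qed
  have b1: "V (x ^ 1) \<in> lat eV"
  proof -
    have "9 * x ^ 0 + 729 * x ^ 1 + 15624 * x ^ 2 + 129600 * x ^ 3 + 373248 * x ^ 4 \<in> lat eV"
      by (intro lat.add lat_numeral) (simp_all add: eV_def)
    then show ?thesis by (simp add: V_x)
  qed
  have b2: "9 * V (x ^ 2) \<in> lat eV"
  proof -
    have "9 * x ^ 0 + 6066 * x ^ 1 + 495801 * x ^ 2 + 15812496 * x ^ 3 + 253202112 * x ^ 4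
        + 2180141568 * x ^ 5 + 9674588160 * x ^ 6 + 17414258688 * x ^ 7 \<in> lat eV"
      by (intro lat.add lat_numeral) (simp_all add: eV_def)
    then show ?thesis by (simp add: V_x2 algebra_simps)
  qed
  have b3: "27 * V (x ^ 3) \<in> lat eV"
  proof -
    have "27 * V (x ^ 3) = 3 * c2 * (9 * V (x ^ 2)) + 3 * (3 * (3 * c1 * V (x ^ 1))) + 3 * (3 * (3 * c0 * V (x ^ 0)))"
      using V_x_power_rec[of 0] by (simp add: algebra_simps flip: power2_eq_square)
    also have "\<dots> \<in> lat eV" by (intro lat.add lat_3_mult lat_eV_mult b0 b1 b2)
    finally show ?thesis .
  qed
  show ?case
  proof (cases n rule: nat_cases5)
    case 5
    have "81 * V (x ^ 4) = 3 * c2 * (27 * V (x ^ 3)) + 3 * (3 * c1 * (9 * V (x ^ 2))) + 3 * (3 * (3 * (3 * c0 * V (x ^ 1))))"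
      using V_x_power_rec[of 1] by (simp only: nat_add_numerals) (simp add: algebra_simps)
    also have "\<dots> \<in> lat eV" by (intro lat.add lat_3_mult lat_eV_mult b1 b2 b3)
    finally show ?thesis by (simp add: 5 eH_def)
  next
    case (6 m)
    have "3 ^ eH n * V (x ^ n) = 3 * c2 * (3 ^ eH (m + 4) * V (x ^ (m + 4)))
       + 3 * (3 * c1 * (3 ^ eH (m + 3) * V (x ^ (m + 3)))) + 3 * (3 * (3 * c0 * (3 ^ eH (m + 2) * V (x ^ (m + 2)))))"
      using V_x_power_rec[of "m + 2"] by (simp add: 6 eH_def eval_nat_numeral algebra_simps)
    also have "\<dots> \<in> lat eV" by (intro lat.add lat_3_mult lat_eV_mult less) (simp_all add: 6)
    finally show ?thesis .
  qed (use b0 b1 b2 b3 in \<open>simp_all add: eH_def\<close>)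
qed

lemma sect_0_lat: "p \<in> lat eG \<Longrightarrow> sect 0 p \<in> lat eH"
  by (induction rule: lat.induct)
     (simp_all add: sect_const sect_0_x_power sect_add sect_diff lat.add lat.diff)

lemma V_lat: "p \<in> lat eH \<Longrightarrow> V p \<in> lat eV"
proof (induction rule: lat.induct)
  case (base n)
  have "V (3 ^ eH n * x ^ n) = 3 ^ eH n * V (x ^ n)"
    using V_mult_E[of "x ^ n" "3 ^ eH n"] by (simp add: E_power E_numeral mult.commute)
  then show ?case by (simp add: V_x_power)
qed (simp_all add: V_add V_diff lat.add lat.diff)

lemma lat_eV: "p \<in> lat eV \<Longrightarrow> \<exists>p' \<in> lat eG. p = 9 * p'"
proof (induction rule: lat.induct)
  case (base n)
  show ?case by (rule bexI[OF _ lat.base[of eG n]]) (simp add: eV_def eG_def power_add)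
next
  case (add p q)
  then show ?case by (metis distrib_left lat.add)
next
  case (diff p q)
  then show ?case by (metis right_diff_distrib lat.diff)
qed

section \<open>Integrality of the coefficients\<close>

definition int_fps :: "rat fps \<Rightarrow> bool" where
  "int_fps F \<longleftrightarrow> (\<forall>n. F $ n \<in> \<int>)"

lemma int_fps_add: "int_fps F \<Longrightarrow> int_fps G \<Longrightarrow> int_fps (F + G)"
  and int_fps_diff: "int_fps F \<Longrightarrow> int_fps G \<Longrightarrow> int_fps (F - G)"
  and int_fps_minus: "int_fps F \<Longrightarrow> int_fps (- F)"
  and int_fps_1: "int_fps 1"
  and int_fps_X: "int_fps X"
  and int_fps_numeral: "int_fps (numeral k)"
  by (auto simp: int_fps_def fps_X_def numeral_fps_const)

lemma int_fps_mult: "int_fps F \<Longrightarrow> int_fps G \<Longrightarrow> int_fps (F * G)"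
  by (auto simp: int_fps_def fps_mult_nth)

lemma int_fps_power: "int_fps F \<Longrightarrow> int_fps (F ^ n)"
  by (induction n) (auto intro: int_fps_mult int_fps_1)

lemma int_fps_inverse:
  assumes "int_fps F" "F $ 0 = 1" shows "int_fps (inverse F)"
  unfolding int_fps_def
proof
  fix n show "inverse F $ n \<in> \<int>"
  proof (induction n rule: less_induct)
    case (less n)
    show ?case
    proof (cases "n = 0")
      case False
      have "(inverse F * F) $ n = 0" using False assms(2) by (simp add: inverse_mult_eq_1)
      moreover have "(inverse F * F) $ n = (\<Sum>i<n. inverse F $ i * F $ (n - i)) + inverse F $ n"
        unfolding fps_mult_nth atLeast0AtMost lessThan_Suc_atMost[symmetric] using assms(2) by simp
      ultimately have "inverse F $ n = - (\<Sum>i<n. inverse F $ i * F $ (n - i))" by simp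
      also have "\<dots> \<in> \<int>" using less assms(1) by (auto simp: int_fps_def)
      finally show ?thesis .
    qed (use assms in auto)
  qed
qed

lemma int_fps_qpoch: "int_fps a \<Longrightarrow> int_fps q \<Longrightarrow> int_fps (qpoch a q n)"
  unfolding qpoch_def by (induction n) (auto intro: int_fps_mult int_fps_1 int_fps_diff int_fps_power)

lemma int_fps_qinf: "int_fps a \<Longrightarrow> int_fps q \<Longrightarrow> int_fps (qinf a q)"
  using int_fps_qpoch by (auto simp: qinf_def int_fps_def)

lemma int_fps_J: "int_fps (J m)"
  by (intro int_fps_qinf int_fps_power int_fps_X)

lemma int_fps_x: "int_fps x"
proof -
  have "int_fps S" unfolding S_def
    by (intro int_fps_mult int_fps_J int_fps_power int_fps_inverse) (simp add: J_nth_0 fps_power_zeroth)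
  then have "int_fps w" unfolding w_def by (intro int_fps_mult int_fps_X int_fps_power)
  then show ?thesis unfolding x_def T_def
    by (intro int_fps_mult int_fps_inverse int_fps_diff int_fps_1 int_fps_numeral) (simp_all add: w_nth_0)
qed

lemma int_fps_lat: "p \<in> lat e \<Longrightarrow> int_fps p"
  by (induction rule: lat.induct)
     (auto intro: int_fps_mult int_fps_power int_fps_numeral int_fps_x int_fps_add int_fps_diff)

lemma frakb_int: "frakb m \<in> \<int>"
proof -
  have "int_fps (beta_term n)" for n
    unfolding beta_term_def
    by (intro int_fps_mult int_fps_power int_fps_X int_fps_qpoch int_fps_minus int_fps_inverse)
       (simp add: fps_power_zeroth qpoch_nth_0)
  then show ?thesis by (auto simp: frakb_def int_fps_def)
qed

lemma int_fps_E_even_part: "int_fps (E even_part)"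
  by (simp add: int_fps_def fps_compose_X_power_nth even_part_def frakb_int)

section \<open>The congruence\<close>

primrec tower :: "nat \<Rightarrow> rat fps" where
  "tower 0 = sect 2 even_part"
| "tower (Suc a) = sect 2 (sect 0 (tower a))"

text \<open>Extracting exponents 0 turns \<open>E even_part * p\<close> into
  \<open>even_part * sect 0 p\<close>; extracting exponents 2 then restores the factor
  \<open>E even_part\<close> and applies \<open>V\<close>, which yields a new 9.\<close>

lemma tower_lat: "\<exists>p \<in> lat eG. tower a = 9 ^ Suc a * (E even_part * p)"
proof (induction a)
  case 0
  have "1 \<in> lat eH" using lat.base[of eH 0] by (simp add: eH_def)
  from lat_eV[OF V_lat[OF this]] obtain p where "p \<in> lat eG" "V 1 = 9 * p" by blast
  then show ?case using sect_2_V[of 1] by (auto simp: mult_ac)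
next
  case (Suc a)
  then obtain p where p: "p \<in> lat eG" "tower a = 9 ^ Suc a * (E even_part * p)" by blast
  \<comment> \<open>The constant \<open>9 ^ Suc a\<close> is fixed by \<open>E\<close> and so passes
    through \<open>sect\<close>.\<close>
  have "tower a = p * E (even_part * 9 ^ Suc a)"
    unfolding p(2) E_mult E_power E_numeral by (simp only: mult_ac)
  then have "sect 0 (tower a) = sect 0 p * (even_part * 9 ^ Suc a)"
    by (simp only: sect_mult_E)
  also have "\<dots> = even_part * sect 0 p * E (9 ^ Suc a)"
    unfolding E_power E_numeral by (simp only: mult_ac)
  finally have *: "tower (Suc a) = E even_part * V (sect 0 p) * 9 ^ Suc a"
    by (simp add: sect_mult_E sect_2_V)
  obtain p' where p': "p' \<in> lat eG" "V (sect 0 p) = 9 * p'"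
    using lat_eV[OF V_lat[OF sect_0_lat[OF p(1)]]] by blast
  have "tower (Suc a) = 9 ^ Suc (Suc a) * (E even_part * p')"
    unfolding * p'(2) power_Suc[of _ "Suc a"] by (simp only: mult_ac)
  with p'(1) show ?case by blast
qed

text \<open>One round of extractions reads index \<open>9 * n + 6\<close> of the previous series,
  whence the 6.\<close>

primrec offset :: "nat \<Rightarrow> nat" where
  "offset 0 = 2"
| "offset (Suc a) = 3 ^ (2 * a + 1) * 6 + offset a"

lemma tower_nth: "tower a $ n = frakb (2 * (3 ^ (2 * a + 1) * n + offset a))"
proof (induction a arbitrary: n)
  case (Suc a)
  have "tower (Suc a) $ n = tower a $ (9 * n + 6)" by (simp add: sect_def algebra_simps)
  moreover have "3 ^ (2 * a + 1) * (9 * n + 6) + offset a = 3 ^ (2 * Suc a + 1) * n + offset (Suc a)"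
    by (simp add: algebra_simps)
  ultimately show ?case by (simp only: Suc)
qed (simp add: sect_def even_part_def)

lemma offset_eq: "4 * offset a + 1 = 3 ^ (2 * Suc a)"
  by (induction a) simp_all

theorem theorem1p1:
  fixes \<alpha> n :: nat
  assumes "\<alpha> \<ge> 1"
  shows "\<exists>k::int. frakb (2 * 3 ^ (2 * \<alpha> - 1) * n + (3 ^ (2 * \<alpha>) - 1) div 2)
                    = of_int (3 ^ (2 * \<alpha>) * k)"
proof -
  obtain a where a: "\<alpha> = Suc a" using assms by (cases \<alpha>) auto
  obtain p where p: "p \<in> lat eG" "tower a = 9 ^ Suc a * (E even_part * p)" using tower_lat by blast
  have "int_fps (E even_part * p)"
    by (intro int_fps_mult int_fps_E_even_part int_fps_lat[OF p(1)])
  then obtain k where k: "(E even_part * p) $ n = of_int k"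
    unfolding int_fps_def by (meson Ints_cases)
  have "(3 ^ (2 * \<alpha>) - 1) div 2 = 2 * offset a"
    using offset_eq[of a] unfolding a by presburger
  then have "2 * 3 ^ (2 * \<alpha> - 1) * n + (3 ^ (2 * \<alpha>) - 1) div 2 = 2 * (3 ^ (2 * a + 1) * n + offset a)"
    by (simp add: a)
  then have "frakb (2 * 3 ^ (2 * \<alpha> - 1) * n + (3 ^ (2 * \<alpha>) - 1) div 2) = tower a $ n"
    by (simp only: tower_nth)
  also have "\<dots> = (fps_const (9 ^ Suc a) * (E even_part * p)) $ n"
    unfolding p(2) by (simp add: numeral_fps_const fps_const_power)
  also have "\<dots> = 9 ^ Suc a * of_int k" unfolding fps_mult_left_const_nth k ..
  also have "\<dots> = of_int (3 ^ (2 * \<alpha>) * k)"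
    unfolding a power_mult by simp
  finally show ?thesis by blast
qed

end
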